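(* Let $\Psi$ be the distribution function of a probability law on $(0,1]$. Let $(\mathbf F^n,\mathbf G^n)_{n\ge1}$ be a sequence in $\mathcal R$ and let $(\mathbf F,\mathbf G)\in\mathcal R$. Suppose furthermore that (1) $\Psi\in C^1[0,1]$, (2) $\mathbf F^n\to\mathbf F$ and $\mathbf G^n\to\mathbf G$ locally uniformly, (3) the map $(t,x)\mapsto F_t(x)$ is continuous, (4) $\{F_t:t\ge0\}$ is a tight family of distribution functions. Then $(\mathbf F,\mathbf G)\in\mathcal R$ and $\mathscr C(\mathbf F^n,\mathbf G^n)\to\mathscr C(\mathbf F,\mathbf G)$ locally uniformly.
   Context: $L^1_{\mathrm{loc}}$ is the space of functions $f:[0,\infty)\to\mathbb R$ integrable on each $[0,k]$, with metric $d(f,g)=\sum_{k\ge1}2^{-k}\wedge\int_0^k|f-g|\,dx$. $\mathcal D\subset L^1_{\mathrm{loc}}$ is the set of c\`adl\`ag nondecreasing functions $F:[0,\infty]\to[0,1]$ (subdistribution functions); $dF$ is the Lebesgue–Stieltjes measure of $F$ on $(0,\infty)$. "Distribution function" means cumulative distribution function of a probability measure; a family of distribution functions $\{F_t\}$ on $[0,\infty)$ is tight if for all $\epsilon>0$ there is $N>0$ with $F_t(N)>1-\epsilon$ for all $t$. $\mathcal X$ is the set of Borel measurable maps $\mathbf F:t\mapsto F_t$ from $[0,\infty)$ to $\mathcal D$. For time-indexed families of functions in $L^1_{\mathrm{loc}}$, $\mathbf F^{n}\to\mathbf F$ locally uniformly means: for all compact $K\subseteq[0,\infty)$ and all $t>0$,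 $$\lim_{n\to\infty}\sup_{0\le s\le t}\int_K|F^n_s(x)-F_s(x)|\,dx=0 .$$ $\mathcal R=\{(\mathbf F,\mathbf G)\in\mathcal X\times\mathcal X: dG_t\ll dF_t\ \forall t\ge0\}$. For $(\mathbf F,\mathbf G)\in\mathcal R$ (and $\Psi$ absolutely continuous), $\mathscr C(\mathbf F,\mathbf G)$ is defined for $t,x\ge0$ by $$\mathscr C(\mathbf F,\mathbf G)_t(x)=G_0(e^{-t}x)+\int_0^t(e^{s-t}x)^2\left[\int_{e^{s-t}x}^\infty\frac{dG_s}{dF_s}(z)\cdot\frac{d(\Psi(F_s(z)))}{z}\right]ds ,$$ where $d(\Psi\circ F_s)$ is the Lebesgue–Stieltjes measure of $\Psi\circ F_s$ (absolutely continuous with respect to $dF_s$ as $\Psi$ is absolutely continuous), so the inner integral is well defined. *)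

theory Defs
  imports "HOL-Probability.Probability"
begin

text \<open>
  A function on \<open>[0,\<infinity>)\<close> is represented by a total function on the reals whose values at
  negative arguments are irrelevant, and a time-indexed family \<open>t \<mapsto> F\<^sub>t\<close> by a curried function
  \<open>F t x\<close> of which only \<open>t \<ge> 0\<close>, \<open>x \<ge> 0\<close> matter.
\<close>

definition L1_loc :: "(real \<Rightarrow> real) set" where
  "L1_loc = {f. \<forall>k::nat. set_integrable lborel {0..real k} f}"

definition L1_loc_dist :: "(real \<Rightarrow> real) \<Rightarrow> (real \<Rightarrow> real) \<Rightarrow> real" where
  "L1_loc_dist f g =
     (\<Sum>k. min ((1/2) ^ Suc k) (LINT x:{0..real (Suc k)}|lborel. \<bar>f x - g x\<bar>))"

definition cadlag_on_nonneg :: "(real \<Rightarrow> real) \<Rightarrow> bool" where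
  "cadlag_on_nonneg f \<longleftrightarrow>
     (\<forall>x\<ge>0. continuous (at_right x) f) \<and> (\<forall>x>0. \<exists>l. (f \<longlongrightarrow> l) (at_left x))"

text \<open>
  Subdistribution functions. A value at \<open>\<infinity>\<close> is not recorded: it affects neither the \<open>L1_loc\<close>
  distance nor the Stieltjes measure on \<open>(0,\<infinity>)\<close>, and the left limit there exists by monotonicity.
\<close>

definition subdistribution_functions :: "(real \<Rightarrow> real) set" where
  "subdistribution_functions =
     {F \<in> L1_loc. cadlag_on_nonneg F \<and> mono_on {0..} F \<and> F ` {0..} \<subseteq> {0..1}}"

text \<open>
  The Borel sigma-algebra of the metric space of subdistribution functions. Open sets are spelled out
  because \<open>L1_loc_dist\<close> is only a pseudometric on total functions (it ignores negative
  arguments).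
\<close>

definition subdistribution_borel :: "(real \<Rightarrow> real) measure" where
  "subdistribution_borel = sigma subdistribution_functions
     {U. U \<subseteq> subdistribution_functions \<and>
         (\<forall>f\<in>U. \<exists>e>0. \<forall>g\<in>subdistribution_functions. L1_loc_dist f g < e \<longrightarrow> g \<in> U)}"

definition subdistribution_paths :: "(real \<Rightarrow> real \<Rightarrow> real) set" where
  "subdistribution_paths = measurable (restrict_space borel {0..}) subdistribution_borel"

text \<open>
  The Lebesgue--Stieltjes measure of \<open>F\<close> on \<open>(0,\<infinity>)\<close>, as a Borel measure on the reals that
  vanishes outside \<open>(0,\<infinity>)\<close>: freezing \<open>F\<close> at \<open>F 0\<close> to the left of \<open>0\<close> leaves no mass on
  \<open>(-\<infinity>,0]\<close>, in particular no atom of size \<open>F 0\<close> at \<open>0\<close>.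
\<close>

definition stieltjes :: "(real \<Rightarrow> real) \<Rightarrow> real measure" where
  "stieltjes F = interval_measure (\<lambda>x. F (max 0 x))"

definition ac_path_pairs :: "((real \<Rightarrow> real \<Rightarrow> real) \<times> (real \<Rightarrow> real \<Rightarrow> real)) set" where
  "ac_path_pairs = {(F, G). F \<in> subdistribution_paths \<and> G \<in> subdistribution_paths \<and>
     (\<forall>t\<ge>0. absolutely_continuous (stieltjes (F t)) (stieltjes (G t)))}"

text \<open>
  The supremum is taken in the extended nonnegative reals, so that an unbounded family is not
  assigned a junk value. Membership in \<open>L1_loc\<close> is part of the notion.
\<close>

definition converges_locally_uniformly ::
    "(nat \<Rightarrow> real \<Rightarrow> real \<Rightarrow> real) \<Rightarrow> (real \<Rightarrow> real \<Rightarrow> real) \<Rightarrow> bool" where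
  "converges_locally_uniformly Fn F \<longleftrightarrow>
     (\<forall>n. \<forall>s\<ge>0. Fn n s \<in> L1_loc) \<and> (\<forall>s\<ge>0. F s \<in> L1_loc) \<and>
     (\<forall>K t. compact K \<and> K \<subseteq> {0..} \<and> t > 0 \<longrightarrow>
        (\<lambda>n. SUP s\<in>{0..t}. \<integral>\<^sup>+x\<in>K. ennreal \<bar>Fn n s x - F s x\<bar> \<partial>lborel) \<longlonglongrightarrow> 0)"

text \<open>\<open>f\<close> agrees on \<open>A\<close> with the distribution function of a probability law on \<open>S\<close>.\<close>

definition distribution_function ::
    "real set \<Rightarrow> real set \<Rightarrow> (real \<Rightarrow> real) \<Rightarrow> bool" where
  "distribution_function A S f \<longleftrightarrow>
     (\<exists>\<mu>. real_distribution \<mu> \<and> measure \<mu> S = 1 \<and> (\<forall>x\<in>A. f x = cdf \<mu> x))"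

definition tight_distribution_family :: "(real \<Rightarrow> real \<Rightarrow> real) \<Rightarrow> bool" where
  "tight_distribution_family F \<longleftrightarrow>
     (\<forall>t\<ge>0. distribution_function {0..} {0..} (F t)) \<and>
     (\<forall>\<epsilon>>0. \<exists>N>0. \<forall>t\<ge>0. F t N > 1 - \<epsilon>)"

text \<open>
  Derivatives are one-sided at the endpoints; the library's \<open>C1_differentiable_on\<close> asks for
  two-sided ones, which for a distribution function with \<open>\<Psi> 0 = 0\<close>, \<open>\<Psi> 1 = 1\<close> would force
  \<open>\<Psi>'\<close> to vanish at \<open>0\<close> and \<open>1\<close>.
\<close>

definition C1_on_unit_interval :: "(real \<Rightarrow> real) \<Rightarrow> bool" where
  "C1_on_unit_interval \<Psi> \<longleftrightarrow>
     (\<exists>\<Psi>'. continuous_on {0..1} \<Psi>' \<and>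
        (\<forall>u\<in>{0..1}. (\<Psi> has_real_derivative \<Psi>' u) (at u within {0..1})))"

text \<open>
  The inner integral from \<open>y\<close> to \<open>\<infinity>\<close> is over the open half-line \<open>(y,\<infinity>)\<close>. At \<open>x = 0\<close> it may
  diverge, but is multiplied by \<open>0\<close>.
\<close>

definition C_operator ::
    "(real \<Rightarrow> real) \<Rightarrow> (real \<Rightarrow> real \<Rightarrow> real) \<Rightarrow> (real \<Rightarrow> real \<Rightarrow> real) \<Rightarrow> real \<Rightarrow> real \<Rightarrow> real" where
  "C_operator \<Psi> F G t x =
     G 0 (exp (- t) * x) +
     (LINT s:{0..t}|lborel. (exp (s - t) * x)\<^sup>2 *
        (LINT z:{exp (s - t) * x<..}|stieltjes (\<Psi> \<circ> F s).
           enn2real (RN_deriv (stieltjes (F s)) (stieltjes (G s)) z) / z))"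

end

theory Submission
  imports Defs "HOL-Real_Asymp.Real_Asymp"
begin

text \<open>
  The chain rule \<open>d(\<Psi> \<circ> F) = A dF\<close> holds with \<open>A z\<close> the difference quotient of \<open>\<Psi>\<close> between \<open>F(z-)\<close>
  and \<open>F z\<close> (the derivative \<open>\<Psi>'\<close> at \<open>F z\<close> where \<open>F\<close> is continuous), so the inner integral is the integral
  of \<open>A z / z\<close> against \<open>dG\<close>, and it is bounded by \<open>M / y\<close> with \<open>M = sup \<Psi>'\<close>. Since the limit \<open>F\<close> is
  continuous in \<open>x\<close>, so is \<open>G\<close> on \<open>(0,\<infinity>)\<close>, and \<open>L1_loc\<close> convergence of the monotone functions is pointwise
  convergence on \<open>(0,\<infinity>)\<close>; Riemann--Stieltjes sums then give pointwise convergence of the inner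
  integral (the factor \<open>1/z\<close> controls the tail), and dominated convergence on \<open>[0,t] \<times> [0,k]\<close> after
  the substitution \<open>y = e^(s-t) x\<close> gives uniformity in time.
\<close>

subsection \<open>Distribution functions and difference quotients\<close>

text \<open>Nothing is assumed about convergence of the densities of \<open>G^n\<close> with respect
  to \<open>F^n\<close>; the chain rule removes them, at the price of a factor depending on
  \<open>F^n\<close>. The \<open>F^n\<close> may jump although the limit does not, so this factor is
  a quotient across the jump and not a value of \<open>\<psi>\<close>. The mean value theorem makes
  it close to \<open>\<psi>\<close> of the limit as soon as \<open>F^n\<close> is close to the limit
  at finitely many grid points. Pointwise convergence can fail at 0, since mass of
  \<open>G^n\<close> may collapse there, and the bound \<open>M / y\<close> blows up there; but the
  operator multiplies by \<open>y^2\<close>, which leaves \<open>M * y\<close>. Uniformity in time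
  costs only a Jacobian: one space-time integral, times \<open>exp t\<close>, bounds the errors at
  all times \<open>s \<le> t\<close> simultaneously. The work is done with monotone right-continuous
  functions on the whole line (\<open>subdf\<close>), the natural input of
  \<open>interval_measure\<close>; a path enters by freezing it to the left of 0.\<close>

definition subdf :: "(real \<Rightarrow> real) \<Rightarrow> bool" where
  "subdf H \<longleftrightarrow> mono H \<and> (\<forall>x. continuous (at_right x) H) \<and> range H \<subseteq> {0..1}"

lemma subdf_mono: "subdf H \<Longrightarrow> x \<le> y \<Longrightarrow> H x \<le> H y"
  and subdf_right_continuous: "subdf H \<Longrightarrow> continuous (at_right x) H"
  and subdf_nonneg: "subdf H \<Longrightarrow> 0 \<le> H x"
  and subdf_le_1: "subdf H \<Longrightarrow> H x \<le> 1"
  by (auto simp: subdf_def mono_def image_subset_iff)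

lemma emeasure_subdf_Ioc:
  "subdf H \<Longrightarrow> a \<le> b \<Longrightarrow> emeasure (interval_measure H) {a<..b} = ennreal (H b - H a)"
  by (rule emeasure_interval_measure_Ioc) (auto intro: subdf_mono subdf_right_continuous)

lemma measure_subdf_Ioc:
  "subdf H \<Longrightarrow> a \<le> b \<Longrightarrow> measure (interval_measure H) {a<..b} = H b - H a"
  by (simp add: measure_def emeasure_subdf_Ioc subdf_mono)

lemma emeasure_subdf_le_1:
  assumes "subdf H"
  shows "emeasure (interval_measure H) A \<le> 1"
proof -
  have "(SUP n::nat. emeasure (interval_measure H) {- real n<..real n}) =
      emeasure (interval_measure H) (\<Union>n::nat. {- real n<..real n})"
    by (rule SUP_emeasure_incseq) (auto simp: incseq_def)
  also have "\<dots> = emeasure (interval_measure H) UNIV"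
    by (simp add: UN_Ioc_eq_UNIV)
  finally have "emeasure (interval_measure H) UNIV =
      (SUP n::nat. emeasure (interval_measure H) {- real n<..real n})" by simp
  also have "\<dots> \<le> 1"
  proof (rule SUP_least)
    fix n :: nat
    have "H (real n) - H (- real n) \<le> 1"
      using subdf_nonneg[OF assms, of "- real n"] subdf_le_1[OF assms, of "real n"] by linarith
    then show "emeasure (interval_measure H) {- real n<..real n} \<le> 1"
      by (simp add: emeasure_subdf_Ioc[OF assms] ennreal_le_1)
  qed
  finally show ?thesis
    using emeasure_space[of "interval_measure H" A] by simp
qed

lemma subprob_space_subdf: "subdf H \<Longrightarrow> subprob_space (interval_measure H)"
  by (rule subprob_spaceI) (simp_all add: emeasure_subdf_le_1)

lemma finite_borel_measure_subdf: "subdf H \<Longrightarrow> finite_borel_measure (interval_measure H)"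
  using subprob_space_subdf[of H]
  by (simp add: finite_borel_measure_def finite_borel_measure_axioms_def subprob_space_def)

text \<open>The left limit \<open>H(z-)\<close> is written as \<open>H z\<close> minus the mass of the atom at \<open>z\<close>, which
  needs no choice of a limit and is measurable in parameters of \<open>H\<close>.\<close>

lemma subdf_at_left:
  assumes "subdf H"
  shows "(H \<longlongrightarrow> H z - measure (interval_measure H) {z}) (at_left z)"
proof -
  interpret finite_borel_measure "interval_measure H"
    by (rule finite_borel_measure_subdf[OF assms])
  let ?M = "interval_measure H"
  \<comment> \<open>\<open>H\<close> need not tend to 0 at minus infinity, so it equals the cdf of
    its measure only up to a constant.\<close>
  have eq: "H x = cdf ?M x + (H z - cdf ?M z)" for x
  proof -
    have *: "H b - H a = cdf ?M b - cdf ?M a" if "a < b" for a b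
      using cdf_diff_eq[OF that] measure_subdf_Ioc[OF assms, of a b] that by simp
    show ?thesis using *[of x z] *[of z x] by (cases x z rule: linorder_cases) auto
  qed
  have "cdf ?M z = measure ?M {..<z} + measure ?M {z}"
    unfolding cdf_def ivl_disj_un(2)[symmetric] by (subst finite_measure_Union) auto
  moreover have "((\<lambda>x. cdf ?M x + (H z - cdf ?M z)) \<longlongrightarrow> measure ?M {..<z} + (H z - cdf ?M z)) (at_left z)"
    by (intro tendsto_intros cdf_at_left)
  ultimately show ?thesis
    by (subst (1) eq[abs_def]) simp
qed

text \<open>The atom at \<open>z\<close> lies in the interval (a,z], whose mass is
  \<open>H z - H a\<close>.\<close>

lemma subdf_left_limit_ge:
  assumes "subdf H" "a < z"
  shows "H a \<le> H z - measure (interval_measure H) {z}"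
proof -
  interpret finite_borel_measure "interval_measure H"
    by (rule finite_borel_measure_subdf[OF assms(1)])
  have "measure (interval_measure H) {z} \<le> measure (interval_measure H) {a<..z}"
    using assms by (intro finite_measure_mono) auto
  then show ?thesis using measure_subdf_Ioc[OF assms(1), of a z] assms(2) by simp
qed

lemma subdf_left_limit_bounds:
  assumes "subdf H"
  shows "0 \<le> H z - measure (interval_measure H) {z}" "H z - measure (interval_measure H) {z} \<le> H z"
  using subdf_left_limit_ge[OF assms, of "z - 1" z] subdf_nonneg[OF assms, of "z - 1"]
  by auto

section \<open>Difference quotients, extended to the diagonal by the derivative\<close>

definition slope :: "(real \<Rightarrow> real) \<Rightarrow> (real \<Rightarrow> real) \<Rightarrow> real \<Rightarrow> real \<Rightarrow> real" where
  "slope \<Psi> \<psi> p q = (if p = q then \<psi> p else (\<Psi> q - \<Psi> p) / (q - p))"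

definition chain_density :: "(real \<Rightarrow> real) \<Rightarrow> (real \<Rightarrow> real) \<Rightarrow> (real \<Rightarrow> real) \<Rightarrow> real \<Rightarrow> real" where
  "chain_density \<Psi> \<psi> H z = slope \<Psi> \<psi> (H z - measure (interval_measure H) {z}) (H z)"

text \<open>The derivative \<open>\<psi>\<close> is a parameter because \<open>slope\<close> takes
  it as its value on the diagonal. Everything is confined to [0,1], where a \<open>subdf\<close>
  takes its values.\<close>

locale C1_unit =
  fixes \<Psi> \<psi> :: "real \<Rightarrow> real"
  assumes continuous_deriv: "continuous_on {0..1} \<psi>"
    and has_deriv: "u \<in> {0..1} \<Longrightarrow> (\<Psi> has_real_derivative \<psi> u) (at u within {0..1})"
    and mono: "mono_on {0..1} \<Psi>"
    and in_unit: "u \<in> {0..1} \<Longrightarrow> \<Psi> u \<in> {0..1}"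
begin

lemma continuous_Psi: "continuous_on {0..1} \<Psi>"
  using has_deriv by (blast intro: DERIV_continuous_on)

text \<open>Admitting the endpoints for \<open>\<xi>\<close> lets the diagonal count as a case, so
  bounds and continuity estimates for \<open>\<psi>\<close> carry over to \<open>slope\<close> at
  once.\<close>

lemma slope_mean_value:
  assumes "0 \<le> p" "p \<le> q" "q \<le> 1"
  obtains \<xi> where "\<xi> \<in> {p..q}" "slope \<Psi> \<psi> p q = \<psi> \<xi>"
proof (cases "p = q")
  case True
  then show ?thesis using that[of p] by (simp add: slope_def)
next
  case False
  have "\<exists>x\<in>{p..q}. \<Psi> q - \<Psi> p = \<psi> x * (q - p)"
  proof (rule mvt_very_simple)
    show "p \<le> q" by fact
    fix x assume "p \<le> x" "x \<le> q"
    then have "(\<Psi> has_real_derivative \<psi> x) (at x within {p..q})"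
      using assms has_deriv[of x] by (auto elim!: DERIV_subset)
    then show "(\<Psi> has_derivative (*) (\<psi> x)) (at x within {p..q})"
      by (simp add: has_field_derivative_def)
  qed
  then show ?thesis using that False by (auto simp: slope_def)
qed

text \<open>One \<open>\<delta>\<close> serves all \<open>r\<close>, since \<open>\<psi>\<close> is
  uniformly continuous on [0,1] and the mean value point lies between \<open>p\<close> and
  \<open>q\<close>.\<close>

lemma slope_near_diagonal:
  assumes "\<epsilon> > 0"
  obtains \<delta> where "\<delta> > 0"
    "\<And>p q r. \<lbrakk>0 \<le> p; p \<le> q; q \<le> 1; r \<in> {0..1}; \<bar>p - r\<bar> < \<delta>; \<bar>q - r\<bar> < \<delta>\<rbrakk> \<Longrightarrow> \<bar>slope \<Psi> \<psi> p q - \<psi> r\<bar> < \<epsilon>"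
proof -
  have "uniformly_continuous_on {0..1} \<psi>"
    by (simp add: compact_uniformly_continuous continuous_deriv)
  then obtain \<delta> where \<delta>: "\<delta> > 0"
    "\<And>x y. \<lbrakk>x \<in> {0..1}; y \<in> {0..1}; dist x y < \<delta>\<rbrakk> \<Longrightarrow> dist (\<psi> x) (\<psi> y) < \<epsilon>"
    using assms unfolding uniformly_continuous_on_def by metis
  show ?thesis
  proof (rule that[OF \<delta>(1)])
    fix p q r :: real
    assume *: "0 \<le> p" "p \<le> q" "q \<le> 1" "r \<in> {0..1}" "\<bar>p - r\<bar> < \<delta>" "\<bar>q - r\<bar> < \<delta>"
    obtain \<xi> where "\<xi> \<in> {p..q}" "slope \<Psi> \<psi> p q = \<psi> \<xi>"
      using slope_mean_value[OF *(1-3)] .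
    with * \<delta>(2)[of \<xi> r] show "\<bar>slope \<Psi> \<psi> p q - \<psi> r\<bar> < \<epsilon>"
      by (auto simp: dist_real_def)
  qed
qed

text \<open>At a limit on the diagonal the quotient degenerates to 0/0 and
  \<open>slope_near_diagonal\<close> takes over; off the diagonal \<open>p m < q m\<close>
  eventually, and the quotient formula passes to the limit. This is joint continuity on the triangle
  0 \<le> p \<le> q \<le> 1.\<close>

lemma slope_tendsto:
  assumes p: "p \<longlonglongrightarrow> p0" and q: "q \<longlonglongrightarrow> q0"
    and bnd: "\<And>m. 0 \<le> p m" "\<And>m. p m \<le> q m" "\<And>m. q m \<le> 1"
  shows "(\<lambda>m. slope \<Psi> \<psi> (p m) (q m)) \<longlonglongrightarrow> slope \<Psi> \<psi> p0 q0"
proof -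
  have lim: "0 \<le> p0" "p0 \<le> q0" "q0 \<le> 1"
    using LIMSEQ_le_const[OF p, of 0] LIMSEQ_le[OF p q] LIMSEQ_le_const2[OF q, of 1] bnd by auto
  show ?thesis
  proof (cases "p0 = q0")
    case True
    show ?thesis
    proof (rule LIMSEQ_I)
      fix e :: real assume "e > 0"
      then obtain d where d: "d > 0"
        "\<And>p q r. \<lbrakk>0 \<le> p; p \<le> q; q \<le> 1; r \<in> {0..1}; \<bar>p - r\<bar> < d; \<bar>q - r\<bar> < d\<rbrakk> \<Longrightarrow> \<bar>slope \<Psi> \<psi> p q - \<psi> r\<bar> < e"
        using slope_near_diagonal by metis
      obtain N1 where N1: "\<And>m. m \<ge> N1 \<Longrightarrow> \<bar>p m - p0\<bar> < d" using LIMSEQ_D[OF p d(1)] by auto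
      obtain N2 where N2: "\<And>m. m \<ge> N2 \<Longrightarrow> \<bar>q m - p0\<bar> < d" using LIMSEQ_D[OF q d(1)] True by auto
      have "\<forall>m\<ge>max N1 N2. norm (slope \<Psi> \<psi> (p m) (q m) - slope \<Psi> \<psi> p0 q0) < e"
        using d(2)[OF bnd(1) bnd(2) bnd(3), of p0] N1 N2 lim True
        by (auto simp: slope_def[of \<Psi> \<psi> q0 q0])
      then show "\<exists>N. \<forall>m\<ge>N. norm (slope \<Psi> \<psi> (p m) (q m) - slope \<Psi> \<psi> p0 q0) < e" by blast
    qed
  next
    case False
    have "(\<lambda>m. \<Psi> (p m)) \<longlonglongrightarrow> \<Psi> p0" "(\<lambda>m. \<Psi> (q m)) \<longlonglongrightarrow> \<Psi> q0"
      using lim bnd order_trans[OF bnd(1,2)] order_trans[OF bnd(2,3)]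
      by (auto intro!: continuous_on_tendsto_compose[OF continuous_Psi] p q always_eventually)
    then have "(\<lambda>m. (\<Psi> (q m) - \<Psi> (p m)) / (q m - p m)) \<longlonglongrightarrow> (\<Psi> q0 - \<Psi> p0) / (q0 - p0)"
      using False by (intro tendsto_intros p q) auto
    moreover have "\<forall>\<^sub>F m in sequentially. 0 < q m - p m"
      using order_tendstoD(1)[OF tendsto_diff[OF q p], of 0] lim False by auto
    then have "\<forall>\<^sub>F m in sequentially. (\<Psi> (q m) - \<Psi> (p m)) / (q m - p m) = slope \<Psi> \<psi> (p m) (q m)"
      by eventually_elim (auto simp: slope_def)
    ultimately show ?thesis using False by (simp add: slope_def[of _ _ p0] Lim_transform_eventually)
  qed
qed

lemma slope_nonneg:
  assumes "0 \<le> p" "p \<le> q" "q \<le> 1"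
  shows "0 \<le> slope \<Psi> \<psi> p q"
proof -
  have pos: "0 \<le> slope \<Psi> \<psi> p q" if "0 \<le> p" "p < q" "q \<le> 1" for p q
    using that mono by (auto simp: slope_def mono_on_def)
  show ?thesis
  proof (cases "p = q")
    case True
    \<comment> \<open>Moving down by a fraction of \<open>p\<close> and up by the same fraction of
      \<open>1 - p\<close> stays inside [0,1] even at the endpoints, and the gap 1/(m+2) stays
      positive, so the strict case applies to each pair.\<close>
    define p' where "p' m = p - p / (real m + 2)" for m :: nat
    define q' where "q' m = p + (1 - p) / (real m + 2)" for m :: nat
    have "p' \<longlonglongrightarrow> p - 0" "q' \<longlonglongrightarrow> p + 0"
      unfolding p'_def q'_def
      by (intro tendsto_intros; real_asymp)+
    moreover have *: "0 \<le> p' m \<and> p' m < q' m \<and> q' m \<le> 1" for m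
    proof -
      have "p / (real m + 2) \<le> p" "(1 - p) / (real m + 2) \<le> 1 - p"
        using assms True frac_le[of p p 1 "real m + 2"] frac_le[of "1 - p" "1 - p" 1 "real m + 2"] by auto
      moreover have "0 < p / (real m + 2) + (1 - p) / (real m + 2)"
        by (simp flip: add_divide_distrib)
      ultimately show ?thesis by (simp add: p'_def q'_def)
    qed
    ultimately have "(\<lambda>m. slope \<Psi> \<psi> (p' m) (q' m)) \<longlonglongrightarrow> slope \<Psi> \<psi> p p"
      by (intro slope_tendsto) (auto intro: less_imp_le)
    moreover have "0 \<le> slope \<Psi> \<psi> (p' m) (q' m)" for m
      using * by (intro pos) auto
    ultimately show ?thesis using True LIMSEQ_le_const by blast
  next
    case False
    then show ?thesis using pos assms by simp
  qed
qed

lemma slope_bounded: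
  obtains M where "M > 0" "\<And>p q. \<lbrakk>0 \<le> p; p \<le> q; q \<le> 1\<rbrakk> \<Longrightarrow> slope \<Psi> \<psi> p q \<le> M"
proof -
  have "bounded (\<psi> ` {0..1})"
    by (intro compact_imp_bounded compact_continuous_image continuous_deriv) simp
  then obtain M where M: "M > 0" "\<And>x. x \<in> {0..1} \<Longrightarrow> \<bar>\<psi> x\<bar> \<le> M"
    by (auto simp: bounded_pos)
  show ?thesis
  proof (rule that[OF M(1)])
    fix p q :: real assume *: "0 \<le> p" "p \<le> q" "q \<le> 1"
    obtain \<xi> where "\<xi> \<in> {p..q}" "slope \<Psi> \<psi> p q = \<psi> \<xi>"
      using slope_mean_value[OF *] .
    then show "slope \<Psi> \<psi> p q \<le> M" using M(2)[of \<xi>] * by auto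
  qed
qed

text \<open>Continuity of \<open>slope\<close> is known only on the triangle, so the pair of
  functions is routed through the Borel space restricted to it.\<close>

lemma slope_measurable:
  assumes "p \<in> borel_measurable N" "q \<in> borel_measurable N"
    and "\<And>x. x \<in> space N \<Longrightarrow> 0 \<le> p x" "\<And>x. x \<in> space N \<Longrightarrow> p x \<le> q x"
    and "\<And>x. x \<in> space N \<Longrightarrow> q x \<le> 1"
  shows "(\<lambda>x. slope \<Psi> \<psi> (p x) (q x)) \<in> borel_measurable N"
proof -
  let ?R = "{z. 0 \<le> fst z \<and> fst z \<le> snd z \<and> snd z \<le> (1::real)}"
  have "continuous_on ?R (\<lambda>z. slope \<Psi> \<psi> (fst z) (snd z))"
    unfolding continuous_on_sequentially
    by (auto simp: o_def intro!: slope_tendsto dest: tendsto_fst tendsto_snd)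
  then have "(\<lambda>z. slope \<Psi> \<psi> (fst z) (snd z)) \<in> borel_measurable (restrict_space borel ?R)"
    by (rule borel_measurable_continuous_on_restrict)
  moreover have "(\<lambda>x. (p x, q x)) \<in> measurable N (restrict_space borel ?R)"
    using assms by (intro measurable_restrict_space2) (auto intro!: borel_measurable_Pair)
  ultimately have "(\<lambda>z. slope \<Psi> \<psi> (fst z) (snd z)) \<circ> (\<lambda>x. (p x, q x)) \<in> borel_measurable N"
    by (rule measurable_comp[rotated])
  then show ?thesis by (simp add: o_def)
qed

end

subsection \<open>The chain rule for Stieltjes measures\<close>

lemma subdf_measurable: "subdf H \<Longrightarrow> H \<in> borel_measurable borel"
  by (simp add: subdf_def borel_measurable_mono)

lemma subdf_tendsto_from_right:
  assumes "subdf H" "w \<longlonglongrightarrow> z" "\<And>m. z \<le> w m"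
  shows "(\<lambda>m. H (w m)) \<longlonglongrightarrow> H z"
proof -
  have "at z within {z..} = at_right z"
    by (auto simp: at_within_def intro: arg_cong)
  then have "continuous (at z within {z..}) H"
    using subdf_right_continuous[OF assms(1)] by simp
  then show ?thesis
    using assms by (auto simp: continuous_within_sequentially o_def)
qed

text \<open>Strictness matters here: a term \<open>w m = z\<close> would contribute
  \<open>H z\<close>, which differs from the left limit by the atom. From the right such terms are
  harmless.\<close>

lemma subdf_tendsto_from_left:
  assumes "subdf H" "w \<longlonglongrightarrow> z" "\<And>m. w m < z"
  shows "(\<lambda>m. H (w m)) \<longlonglongrightarrow> H z - measure (interval_measure H) {z}"
proof -
  have "filterlim w (at_left z) sequentially"
    using assms by (auto simp: filterlim_at intro!: always_eventually dest: less_imp_neq)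
  from filterlim_compose[OF subdf_at_left[OF assms(1)] this] show ?thesis .
qed

text \<open>On each cell the error is at most \<open>\<epsilon>\<close> times the mass of the cell,
  and the masses add up to the total increment. With \<open>\<epsilon> = 0\<close> this integrates a
  step function exactly, as the chain rule requires; positive \<open>\<epsilon>\<close> serves the
  limit of the inner integrals.\<close>

lemma stieltjes_riemann_sum:
  fixes x :: "nat \<Rightarrow> real"
  assumes H: "subdf H" and x: "mono x" and f[measurable]: "f \<in> borel_measurable borel"
    and c: "\<And>i z. \<lbrakk>i < k; x i < z; z \<le> x (Suc i)\<rbrakk> \<Longrightarrow> \<bar>f z - c i\<bar> \<le> \<epsilon>"
  shows "set_integrable (interval_measure H) {x 0<..x k} f"
    and "\<bar>(LINT z:{x 0<..x k}|interval_measure H. f z) - (\<Sum>i<k. c i * (H (x (Suc i)) - H (x i)))\<bar>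
      \<le> \<epsilon> * (H (x k) - H (x 0))"
proof -
  interpret finite_borel_measure "interval_measure H"
    by (rule finite_borel_measure_subdf[OF H])
  let ?M = "interval_measure H"
  have "set_integrable ?M {x 0<..x k} f \<and>
    \<bar>(LINT z:{x 0<..x k}|?M. f z) - (\<Sum>i<k. c i * (H (x (Suc i)) - H (x i)))\<bar> \<le> \<epsilon> * (H (x k) - H (x 0))"
    using c
  proof (induction k)
    case 0
    then show ?case by (simp add: set_integrable_def set_lebesgue_integral_def)
  next
    case (Suc k)
    have IH: "set_integrable ?M {x 0<..x k} f"
      "\<bar>(LINT z:{x 0<..x k}|?M. f z) - (\<Sum>i<k. c i * (H (x (Suc i)) - H (x i)))\<bar> \<le> \<epsilon> * (H (x k) - H (x 0))"
      using Suc by auto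
    let ?I = "{x k<..x (Suc k)}"
    have le: "x k \<le> x (Suc k)" "x 0 \<le> x k" using x by (auto simp: mono_def)
    have const: "set_integrable ?M ?I (\<lambda>_. d)" for d :: real
      unfolding set_integrable_def
      by (rule integrable_const_bound[where B="\<bar>d\<bar>"]) (auto simp: indicator_def intro!: AE_I2)
    \<comment> \<open>The bound contains the absolute value of \<open>\<epsilon>\<close> because its
      sign is unknown: on an empty cell the hypothesis on \<open>c\<close> says nothing.\<close>
    have int: "set_integrable ?M ?I f"
      unfolding set_integrable_def
    proof (rule integrable_const_bound[where B="\<bar>c k\<bar> + \<bar>\<epsilon>\<bar>"])
      show "AE z in ?M. norm (indicat_real ?I z *\<^sub>R f z) \<le> \<bar>c k\<bar> + \<bar>\<epsilon>\<bar>"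
        using Suc.prems[of k] by (intro always_eventually) (auto simp: indicator_def, smt (verit))
    qed measurable
    have cint: "(LINT z:?I|?M. d) = d * (H (x (Suc k)) - H (x k))" for d
      using measure_subdf_Ioc[OF H le(1)] by (subst set_integral_const) auto
    have "(LINT z:?I|?M. f z) \<le> (LINT z:?I|?M. c k + \<epsilon>)"
      using Suc.prems[of k] by (intro set_integral_mono int const) (smt (verit) greaterThanAtMost_iff lessI)
    moreover have "(LINT z:?I|?M. c k - \<epsilon>) \<le> (LINT z:?I|?M. f z)"
      using Suc.prems[of k] by (intro set_integral_mono int const) (smt (verit) greaterThanAtMost_iff lessI)
    ultimately have step: "\<bar>(LINT z:?I|?M. f z) - c k * (H (x (Suc k)) - H (x k))\<bar> \<le> \<epsilon> * (H (x (Suc k)) - H (x k))"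
      by (simp add: cint algebra_simps abs_le_iff)
    have un: "{x 0<..x (Suc k)} = {x 0<..x k} \<union> ?I" using le by auto
    show ?case
    proof
      show "set_integrable ?M {x 0<..x (Suc k)} f"
        unfolding un using IH(1) int by (rule set_integrable_Un) auto
      have "(LINT z:{x 0<..x (Suc k)}|?M. f z) = (LINT z:{x 0<..x k}|?M. f z) + (LINT z:?I|?M. f z)"
        unfolding un by (rule set_integral_Un[OF _ IH(1) int]) auto
      then show "\<bar>(LINT z:{x 0<..x (Suc k)}|?M. f z) - (\<Sum>i<Suc k. c i * (H (x (Suc i)) - H (x i)))\<bar>
          \<le> \<epsilon> * (H (x (Suc k)) - H (x 0))"
        using step IH(2) by (simp add: algebra_simps abs_le_iff)
    qed
  qed
  then show "set_integrable (interval_measure H) {x 0<..x k} f"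
    and "\<bar>(LINT z:{x 0<..x k}|interval_measure H. f z) - (\<Sum>i<k. c i * (H (x (Suc i)) - H (x i)))\<bar>
      \<le> \<epsilon> * (H (x k) - H (x 0))" by auto
qed

context C1_unit
begin

lemma subdf_compose:
  assumes "subdf H"
  shows "subdf (\<lambda>x. \<Psi> (H x))"
proof -
  have H01: "H x \<in> {0..1}" for x using assms by (auto simp: subdf_nonneg subdf_le_1)
  show ?thesis
    unfolding subdf_def
  proof (intro conjI allI)
    show "mono (\<lambda>x. \<Psi> (H x))"
      using mono H01 subdf_mono[OF assms] by (auto simp: mono_on_def intro!: monoI)
    show "continuous (at_right x) (\<lambda>x. \<Psi> (H x))" for x
      using subdf_right_continuous[OF assms, of x] H01 unfolding continuous_within
      by (intro continuous_on_tendsto_compose[OF continuous_Psi]) (auto intro: always_eventually)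
    show "range (\<lambda>x. \<Psi> (H x)) \<subseteq> {0..1}" using in_unit H01 by auto
  qed
qed

lemma chain_density_nonneg: "subdf H \<Longrightarrow> 0 \<le> chain_density \<Psi> \<psi> H z"
  unfolding chain_density_def
  by (intro slope_nonneg subdf_left_limit_bounds subdf_le_1)

text \<open>Bracketing \<open>z\<close> strictly on the left and weakly on the right sends
  \<open>H (l m)\<close> to the left limit and \<open>H (r m)\<close> to \<open>H z\<close>, so
  quotients over shrinking cells see exactly the jump at \<open>z\<close>.\<close>

lemma chain_density_tendsto:
  assumes "subdf H" "l \<longlonglongrightarrow> z" "r \<longlonglongrightarrow> z" "\<And>m. l m < z" "\<And>m. z \<le> r m"
  shows "(\<lambda>m. slope \<Psi> \<psi> (H (l m)) (H (r m))) \<longlonglongrightarrow> chain_density \<Psi> \<psi> H z"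
  unfolding chain_density_def
  using assms order.trans[OF less_imp_le[OF assms(4)] assms(5)]
  by (intro slope_tendsto subdf_tendsto_from_left[OF assms(1,2,4)] subdf_tendsto_from_right[OF assms(1,3,5)])
    (simp_all add: subdf_nonneg subdf_le_1 subdf_mono)

text \<open>On the partition of \<open>(a,b]\<close> into \<open>m + 1\<close> equal pieces, the difference quotients of \<open>\<Psi>\<close> between
  consecutive values of \<open>H\<close> integrate exactly to the increment of \<open>\<Psi> \<circ> H\<close>, and they converge
  boundedly to the density.\<close>

lemma integral_chain_density_Ioc:
  assumes H: "subdf H" and ab: "a < b"
  shows "set_integrable (interval_measure H) {a<..b} (chain_density \<Psi> \<psi> H)"
    and "(LINT z:{a<..b}|interval_measure H. chain_density \<Psi> \<psi> H z) = \<Psi> (H b) - \<Psi> (H a)"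
proof -
  interpret finite_borel_measure "interval_measure H"
    by (rule finite_borel_measure_subdf[OF H])
  let ?M = "interval_measure H"
  note [measurable] = subdf_measurable[OF H]
  obtain M where M: "M > 0" "\<And>p q. \<lbrakk>0 \<le> p; p \<le> q; q \<le> 1\<rbrakk> \<Longrightarrow> slope \<Psi> \<psi> p q \<le> M"
    using slope_bounded by metis
  define h where "h m = (b - a) / (real m + 1)" for m :: nat
  have h: "h m > 0" for m using ab by (simp add: h_def)
  have h0: "h \<longlonglongrightarrow> 0" unfolding h_def by real_asymp
  \<comment> \<open>The point \<open>z\<close> lies in the cell \<open>(l m z, r m z]\<close>;
    rounding by the ceiling makes the cells closed on the right.\<close>
  define l where "l m z = a + (of_int \<lceil>(z - a) / h m\<rceil> - 1) * h m" for m z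
  define r where "r m z = a + of_int \<lceil>(z - a) / h m\<rceil> * h m" for m z
  define s where "s m z = slope \<Psi> \<psi> (H (l m z)) (H (r m z))" for m z
  have lr: "l m z < z" "z \<le> r m z" "r m z = l m z + h m" for m z
  proof -
    have "(of_int \<lceil>(z - a) / h m\<rceil> - 1) * h m < (z - a) / h m * h m"
      using h[of m] by (intro mult_strict_right_mono) linarith+
    then show "l m z < z" using h[of m] by (simp add: l_def)
    have "(z - a) / h m * h m \<le> of_int \<lceil>(z - a) / h m\<rceil> * h m"
      using h[of m] by (intro mult_right_mono) auto
    then show "z \<le> r m z" using h[of m] by (simp add: r_def)
    show "r m z = l m z + h m" by (simp add: r_def l_def algebra_simps)
  qed
  have llim: "(\<lambda>m. l m z) \<longlonglongrightarrow> z" for z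
  proof (rule tendsto_sandwich)
    show "\<forall>\<^sub>F m in sequentially. z - h m \<le> l m z" using lr(2,3)[where z=z] by (simp add: algebra_simps)
    show "\<forall>\<^sub>F m in sequentially. l m z \<le> z" using lr(1) by (simp add: less_imp_le)
    show "(\<lambda>m. z - h m) \<longlonglongrightarrow> z" using tendsto_diff[OF tendsto_const h0, of z] by simp
  qed simp
  have rlim: "(\<lambda>m. r m z) \<longlonglongrightarrow> z" for z
    using tendsto_add[OF llim[of z] h0] by (simp add: lr(3))
  have slim: "(\<lambda>m. s m z) \<longlonglongrightarrow> chain_density \<Psi> \<psi> H z" for z
    unfolding s_def by (intro chain_density_tendsto H llim rlim lr)
  have Hlr: "0 \<le> H (l m z)" "H (l m z) \<le> H (r m z)" "H (r m z) \<le> 1" for m z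
    using lr(1,2)[where m=m and z=z] by (simp_all add: subdf_nonneg subdf_le_1 subdf_mono H)
  have [measurable]: "s m \<in> borel_measurable borel" for m
    unfolding s_def by (intro slope_measurable Hlr) (auto simp: l_def r_def)
  have sbd: "norm (s m z) \<le> M" for m z
    using slope_nonneg[OF Hlr] M(2)[OF Hlr] by (simp add: s_def)
  have chain_meas[measurable]: "chain_density \<Psi> \<psi> H \<in> borel_measurable borel"
    by (rule borel_measurable_LIMSEQ_real[OF slim]) auto
  have sint: "(LINT z:{a<..b}|?M. s m z) = \<Psi> (H b) - \<Psi> (H a)" for m
  proof -
    define x where "x i = a + real i * h m" for i
    have xm: "mono x" using h[of m] by (auto simp: x_def mono_def)
    have x0: "x 0 = a" and xk: "x (Suc m) = b" using ab by (auto simp: x_def h_def field_simps)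
    have ceil: "\<lceil>(z - a) / h m\<rceil> = int i + 1" if "x i < z" "z \<le> x (Suc i)" for i z
      using that h[of m] by (intro ceiling_unique) (auto simp: x_def field_simps)
    have "\<bar>s m z - slope \<Psi> \<psi> (H (x i)) (H (x (Suc i)))\<bar> \<le> 0" if "x i < z" "z \<le> x (Suc i)" for i z
      using ceil[OF that] by (simp add: s_def l_def r_def x_def algebra_simps)
    then have "\<bar>(LINT z:{x 0<..x (Suc m)}|?M. s m z)
        - (\<Sum>i<Suc m. slope \<Psi> \<psi> (H (x i)) (H (x (Suc i))) * (H (x (Suc i)) - H (x i)))\<bar>
      \<le> 0 * (H (x (Suc m)) - H (x 0))"
      by (intro stieltjes_riemann_sum H xm) auto
    \<comment> \<open>If \<open>H\<close> does not grow over the cell, both sides are 0, whatever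
      value \<open>slope\<close> has on the diagonal.\<close>
    moreover have "slope \<Psi> \<psi> (H (x i)) (H (x (Suc i))) * (H (x (Suc i)) - H (x i))
        = \<Psi> (H (x (Suc i))) - \<Psi> (H (x i))" for i
      by (simp add: slope_def)
    ultimately show ?thesis
      using sum_lessThan_telescope[of "\<lambda>i. \<Psi> (H (x i))" "Suc m"]
      by (simp add: x0 xk del: sum.lessThan_Suc)
  qed
  have dom: "integrable ?M (\<lambda>z. indicat_real {a<..b} z *\<^sub>R M)"
    by (rule integrable_const_bound[where B="\<bar>M\<bar>"]) (auto simp: indicator_def intro!: AE_I2)
  have lim: "AE z in ?M. (\<lambda>m. indicat_real {a<..b} z *\<^sub>R s m z) \<longlonglongrightarrow> indicat_real {a<..b} z *\<^sub>R chain_density \<Psi> \<psi> H z"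
    by (intro always_eventually allI tendsto_scaleR tendsto_const slim)
  have bd: "AE z in ?M. norm (indicat_real {a<..b} z *\<^sub>R s m z) \<le> indicat_real {a<..b} z *\<^sub>R M" for m
    using sbd by (intro always_eventually allI) (simp add: indicator_def)
  have 1: "integrable ?M (\<lambda>z. indicat_real {a<..b} z *\<^sub>R chain_density \<Psi> \<psi> H z) "
    by (rule integrable_dominated_convergence[OF _ _ dom lim bd]) measurable
  have 2: "(\<lambda>m. \<integral>z. indicat_real {a<..b} z *\<^sub>R s m z \<partial>?M) \<longlonglongrightarrow>
      (\<integral>z. indicat_real {a<..b} z *\<^sub>R chain_density \<Psi> \<psi> H z \<partial>?M)"
    by (rule integral_dominated_convergence[OF _ _ dom lim bd]) measurable
  show "set_integrable ?M {a<..b} (chain_density \<Psi> \<psi> H)"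
    using 1 by (simp add: set_integrable_def)
  from 2 show "(LINT z:{a<..b}|?M. chain_density \<Psi> \<psi> H z) = \<Psi> (H b) - \<Psi> (H a)"
    using sint by (simp add: set_lebesgue_integral_def LIMSEQ_const_iff)
qed

lemma chain_density_measurable:
  assumes "subdf H"
  shows "chain_density \<Psi> \<psi> H \<in> borel_measurable borel"
proof (rule borel_measurable_LIMSEQ_real)
  fix z
  show "(\<lambda>m. slope \<Psi> \<psi> (H (z - 1 / real (Suc m))) (H z)) \<longlonglongrightarrow> chain_density \<Psi> \<psi> H z"
  proof (intro chain_density_tendsto assms)
    show "(\<lambda>m. z - 1 / real (Suc m)) \<longlonglongrightarrow> z" by real_asymp
  qed auto
next
  fix m :: nat
  note [measurable] = subdf_measurable[OF assms]
  show "(\<lambda>z. slope \<Psi> \<psi> (H (z - 1 / real (Suc m))) (H z)) \<in> borel_measurable borel"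
    by (intro slope_measurable) (auto simp: subdf_nonneg subdf_le_1 subdf_mono assms)
qed

text \<open>The masses of half-open intervals agree by \<open>integral_chain_density_Ioc\<close>,
  and these intervals are stable under intersection and generate the Borel sets. An atom of
  \<open>H\<close> receives the full jump of \<open>\<Psi> \<circ> H\<close>, which
  \<open>\<psi> (H z)\<close> would in general miss.\<close>

lemma interval_measure_compose:
  assumes H: "subdf H"
  shows "interval_measure (\<lambda>x. \<Psi> (H x)) = density (interval_measure H) (\<lambda>z. ennreal (chain_density \<Psi> \<psi> H z))"
proof (rule measure_eqI_generator_eq[where E="range (\<lambda>(a,b). {a<..b::real})" and \<Omega>=UNIV
      and A="\<lambda>n::nat. {- real n<..real n}"])
  note [measurable] = chain_density_measurable[OF H]
  show "Int_stable (range (\<lambda>(a, b). {a<..b::real}))"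
    by (auto simp: Int_stable_def)
  show "sets (interval_measure (\<lambda>x. \<Psi> (H x))) = sigma_sets UNIV (range (\<lambda>(a, b). {a<..b}))"
    by (simp add: borel_sigma_sets_Ioc)
  show "sets (density (interval_measure H) (\<lambda>z. ennreal (chain_density \<Psi> \<psi> H z))) = sigma_sets UNIV (range (\<lambda>(a, b). {a<..b}))"
    by (simp add: borel_sigma_sets_Ioc)
  show "range (\<lambda>n::nat. {- real n<..real n}) \<subseteq> range (\<lambda>(a, b). {a<..b})"
    by (auto intro: range_eqI[where x="(- real n, real n)" for n])
  show "(\<Union>i::nat. {- real i<..real i}) = UNIV" by (rule UN_Ioc_eq_UNIV)
  show "emeasure (interval_measure (\<lambda>x. \<Psi> (H x))) {- real i<..real i} \<noteq> \<infinity>" for i :: nat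
    by (simp add: emeasure_subdf_Ioc[OF subdf_compose[OF H]])
  fix X assume "X \<in> range (\<lambda>(a, b). {a<..b::real})"
  then obtain a b where X: "X = {a<..b}" by auto
  show "emeasure (interval_measure (\<lambda>x. \<Psi> (H x))) X =
    emeasure (density (interval_measure H) (\<lambda>z. ennreal (chain_density \<Psi> \<psi> H z))) X"
  proof (cases "a < b")
    case True
    have "emeasure (density (interval_measure H) (\<lambda>z. ennreal (chain_density \<Psi> \<psi> H z))) X =
      (\<integral>\<^sup>+z. ennreal (indicat_real {a<..b} z *\<^sub>R chain_density \<Psi> \<psi> H z) \<partial>interval_measure H)"
      by (auto simp: emeasure_density X indicator_def intro!: nn_integral_cong)
    also have "\<dots> = ennreal (\<integral>z. indicat_real {a<..b} z *\<^sub>R chain_density \<Psi> \<psi> H z \<partial>interval_measure H)"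
      using integral_chain_density_Ioc(1)[OF H True] chain_density_nonneg[OF H]
      by (intro nn_integral_eq_integral) (auto simp: set_integrable_def)
    also have "\<dots> = ennreal (\<Psi> (H b) - \<Psi> (H a))"
      using integral_chain_density_Ioc(2)[OF H True] by (simp add: set_lebesgue_integral_def)
    finally show ?thesis using True X by (simp add: emeasure_subdf_Ioc[OF subdf_compose[OF H]])
  qed (simp add: X)
qed simp

text \<open>With R dH = dK and d(\<Psi> \<circ> H) = A dH, both sides are the integral of R A / z
  against dH. The rule \<open>integral_density\<close> is an identity also for non-integrable
  functions, hence the statement for every \<open>y\<close>.\<close>

lemma integral_RN_deriv_compose:
  assumes H: "subdf H" and K: "subdf K"
    and ac: "absolutely_continuous (interval_measure H) (interval_measure K)"
  shows "(LINT z:{y<..}|interval_measure (\<lambda>x. \<Psi> (H x)).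
      enn2real (RN_deriv (interval_measure H) (interval_measure K) z) / z) =
    (LINT z:{y<..}|interval_measure K. chain_density \<Psi> \<psi> H z / z)"
proof -
  let ?M = "interval_measure H" and ?N = "interval_measure K"
  interpret M: finite_borel_measure ?M by (rule finite_borel_measure_subdf[OF H])
  interpret N: finite_borel_measure ?N by (rule finite_borel_measure_subdf[OF K])
  define R where "R z = enn2real (RN_deriv ?M ?N z)" for z
  have R[measurable]: "R \<in> borel_measurable ?M" unfolding R_def by measurable
  then have [measurable]: "R \<in> borel_measurable borel" by (simp cong: measurable_cong_sets)
  note [measurable] = chain_density_measurable[OF H]
  \<comment> \<open>\<open>enn2real\<close> sends infinity to 0, so infinity has to be excluded
    almost everywhere before \<open>R\<close> can replace the Radon-Nikodym derivative.\<close>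
  have "AE z in ?M. RN_deriv ?M ?N z \<noteq> \<infinity>"
    by (intro M.RN_deriv_finite N.sigma_finite_measure_axioms ac) simp
  then have "density ?M (\<lambda>z. ennreal (R z)) = density ?M (RN_deriv ?M ?N)"
    by (intro density_cong) (auto simp: R_def top.not_eq_extremum elim!: eventually_mono)
  also have "\<dots> = ?N" by (rule M.density_RN_deriv[OF ac]) simp
  finally have N: "?N = density ?M (\<lambda>z. ennreal (R z))" by simp
  have "(\<integral>z. indicat_real {y<..} z *\<^sub>R (R z / z) \<partial>density ?M (\<lambda>z. ennreal (chain_density \<Psi> \<psi> H z))) =
    (\<integral>z. chain_density \<Psi> \<psi> H z *\<^sub>R (indicat_real {y<..} z *\<^sub>R (R z / z)) \<partial>?M)"
    by (rule integral_density) (auto simp: chain_density_nonneg[OF H])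
  also have "\<dots> = (\<integral>z. R z *\<^sub>R (indicat_real {y<..} z *\<^sub>R (chain_density \<Psi> \<psi> H z / z)) \<partial>?M)"
    by (intro Bochner_Integration.integral_cong) auto
  also have "\<dots> = (\<integral>z. (indicat_real {y<..} z *\<^sub>R (chain_density \<Psi> \<psi> H z / z)) \<partial>density ?M (\<lambda>z. ennreal (R z)))"
    by (rule integral_density[symmetric]) (auto simp: R_def)
  finally show ?thesis
    unfolding set_lebesgue_integral_def interval_measure_compose[OF H] by (simp only: R_def N[unfolded R_def, symmetric])
qed

end

subsection \<open>Continuity of the inner integral\<close>

lemma subdf_isCont_iff:
  assumes "subdf H"
  shows "isCont H z \<longleftrightarrow> measure (interval_measure H) {z} = 0"
proof
  assume "isCont H z"
  then have "(H \<longlongrightarrow> H z) (at_left z)"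
    by (simp add: isCont_def filterlim_at_split)
  from tendsto_unique[OF _ this subdf_at_left[OF assms]]
  show "measure (interval_measure H) {z} = 0" by simp
next
  assume "measure (interval_measure H) {z} = 0"
  then have "(H \<longlongrightarrow> H z) (at_left z)"
    using subdf_at_left[OF assms, of z] by simp
  then show "isCont H z"
    using subdf_right_continuous[OF assms, of z] by (simp add: isCont_def filterlim_at_split continuous_within)
qed

text \<open>If \<open>K\<close> jumped at \<open>z\<close>, the singleton {z} would be null for dH
  but not for dK.\<close>

lemma isCont_absolutely_continuous:
  assumes H: "subdf H" and K: "subdf K"
    and ac: "absolutely_continuous (interval_measure H) (interval_measure K)" and "isCont H z"
  shows "isCont K z"
proof -
  interpret H: finite_borel_measure "interval_measure H" by (rule finite_borel_measure_subdf[OF H])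
  have "measure (interval_measure H) {z} = 0"
    using assms subdf_isCont_iff by blast
  then have "{z} \<in> null_sets (interval_measure H)"
    by (auto simp: null_sets_def H.emeasure_eq_measure)
  then have "{z} \<in> null_sets (interval_measure K)"
    using ac by (auto simp: absolutely_continuous_def)
  then show ?thesis
    using K by (simp add: subdf_isCont_iff measure_eq_0_null_sets)
qed

text \<open>If \<open>|Hn x - H x| \<ge> e\<close>, then by monotonicity \<open>|Hn - H| \<ge> e/2\<close> on a fixed interval on one side
  of \<open>x\<close>.\<close>

lemma subdf_tendsto_of_L1:
  assumes H: "subdf H" and Hn: "\<And>n. subdf (Hn n)" and x: "x > 0" and cont: "isCont H x"
    and L1: "\<And>b. (\<lambda>n. \<integral>\<^sup>+x\<in>{0..b}. ennreal \<bar>Hn n x - H x\<bar> \<partial>lborel) \<longlonglongrightarrow> 0"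
  shows "(\<lambda>n. Hn n x) \<longlonglongrightarrow> H x"
proof (rule tendstoI)
  fix e :: real assume e: "e > 0"
  obtain d0 where d0: "d0 > 0" "\<And>x'. \<bar>x' - x\<bar> < d0 \<Longrightarrow> \<bar>H x' - H x\<bar> < e / 2"
    using cont e unfolding continuous_at_eps_delta by (metis dist_real_def half_gt_zero)
  \<comment> \<open>Half of \<open>d0\<close> keeps distances to \<open>x\<close> strictly below
    \<open>d0\<close>; the cap \<open>x\<close> keeps \<open>x - d\<close> nonnegative, where the L1
    distance is controlled. A discrepancy of height \<open>e / 2\<close> over length
    \<open>d\<close> gives the threshold \<open>d * (e / 2)\<close>.\<close>
  define d where "d = min (d0 / 2) x"
  have d: "d > 0" "d \<le> x" "d < d0" using d0 x by (auto simp: d_def)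
  have "\<forall>\<^sub>F n in sequentially. (\<integral>\<^sup>+x\<in>{0..x + d}. ennreal \<bar>Hn n x - H x\<bar> \<partial>lborel) < ennreal (d * (e / 2))"
    using order_tendstoD(2)[OF L1[of "x + d"]] d e by simp
  then show "\<forall>\<^sub>F n in sequentially. dist (Hn n x) (H x) < e"
  proof eventually_elim
    case (elim n)
    show ?case
    proof (rule ccontr)
      assume "\<not> dist (Hn n x) (H x) < e"
      then consider "Hn n x \<ge> H x + e" | "Hn n x \<le> H x - e" by (auto simp: dist_real_def abs_if split: if_splits)
      then obtain a b where ab: "0 \<le> a" "b = a + d" "b \<le> x + d" "\<And>w. a \<le> w \<Longrightarrow> w \<le> b \<Longrightarrow> e / 2 \<le> \<bar>Hn n w - H w\<bar>"
      proof cases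
        case 1
        have "e / 2 \<le> \<bar>Hn n w - H w\<bar>" if "x \<le> w" "w \<le> x + d" for w
        proof -
          have "\<bar>H w - H x\<bar> < e / 2" using d that by (intro d0) auto
          then show ?thesis using 1 subdf_mono[OF Hn[of n] that(1)] by arith
        qed
        then show ?thesis using that[of x "x + d"] x by simp
      next
        case 2
        have "e / 2 \<le> \<bar>Hn n w - H w\<bar>" if "x - d \<le> w" "w \<le> x" for w
        proof -
          have "\<bar>H w - H x\<bar> < e / 2" using d that by (intro d0) auto
          then show ?thesis using 2 subdf_mono[OF Hn[of n] that(2)] by arith
        qed
        then show ?thesis using that[of "x - d" x] d by simp
      qed
      have "ennreal (d * (e / 2)) = (\<integral>\<^sup>+w. ennreal (e / 2) * indicator {a..b} w \<partial>lborel)"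
        using ab d e by (subst nn_integral_cmult_indicator) (auto simp: mult.commute simp flip: ennreal_mult)
      also have "\<dots> \<le> (\<integral>\<^sup>+w\<in>{0..x + d}. ennreal \<bar>Hn n w - H w\<bar> \<partial>lborel)"
        using ab e by (intro nn_integral_mono) (auto simp: indicator_def intro!: ennreal_leI)
      finally show False using elim by simp
    qed
  qed
qed

section \<open>The inner integral: bounds and limit\<close>

context C1_unit
begin

definition inner_integral :: "(real \<Rightarrow> real) \<Rightarrow> (real \<Rightarrow> real) \<Rightarrow> real \<Rightarrow> real" where
  "inner_integral H K y = (LINT z:{y<..}|interval_measure K. chain_density \<Psi> \<psi> H z / z)"

lemma chain_density_le:
  assumes "subdf H" "\<And>p q. \<lbrakk>0 \<le> p; p \<le> q; q \<le> 1\<rbrakk> \<Longrightarrow> slope \<Psi> \<psi> p q \<le> M"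
  shows "chain_density \<Psi> \<psi> H z \<le> M"
  unfolding chain_density_def
  by (intro assms(2) subdf_left_limit_bounds subdf_le_1 assms(1))

lemma set_integrable_chain_density:
  assumes H: "subdf H" and K: "subdf K" and y: "y > 0" and A: "A \<subseteq> {y<..}" "A \<in> sets borel"
  shows "set_integrable (interval_measure K) A (\<lambda>z. chain_density \<Psi> \<psi> H z / z)"
  unfolding set_integrable_def
proof -
  interpret finite_borel_measure "interval_measure K" by (rule finite_borel_measure_subdf[OF K])
  obtain M where M: "M > 0" "\<And>p q. \<lbrakk>0 \<le> p; p \<le> q; q \<le> 1\<rbrakk> \<Longrightarrow> slope \<Psi> \<psi> p q \<le> M"
    using slope_bounded by metis
  note [measurable] = chain_density_measurable[OF H] A(2)
  show "integrable (interval_measure K) (\<lambda>z. indicat_real A z *\<^sub>R (chain_density \<Psi> \<psi> H z / z))"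
  proof (rule integrable_const_bound[where B="M / y"])
    have "norm (indicat_real A z *\<^sub>R (chain_density \<Psi> \<psi> H z / z)) \<le> M / y" for z
    proof (cases "z \<in> A")
      case True
      then have "y < z" using A by auto
      then have "chain_density \<Psi> \<psi> H z / z \<le> M / y"
        using y M chain_density_le[OF H M(2)] chain_density_nonneg[OF H] by (intro frac_le) auto
      then show ?thesis using True \<open>y < z\<close> y chain_density_nonneg[OF H, of z] by simp
    qed (use M y in auto)
    then show "AE z in interval_measure K. norm (indicat_real A z *\<^sub>R (chain_density \<Psi> \<psi> H z / z)) \<le> M / y"
      by simp
  qed measurable
qed

lemma inner_integral_bounds:
  assumes H: "subdf H" and K: "subdf K" and y: "y > 0"
    and M: "\<And>p q. \<lbrakk>0 \<le> p; p \<le> q; q \<le> 1\<rbrakk> \<Longrightarrow> slope \<Psi> \<psi> p q \<le> M"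
  shows "0 \<le> inner_integral H K y" "inner_integral H K y \<le> M / y"
proof -
  interpret finite_borel_measure "interval_measure K" by (rule finite_borel_measure_subdf[OF K])
  let ?I = "{y<..}"
  have M0: "0 \<le> M" using M[of 0 0] slope_nonneg[of 0 0] by simp
  show "0 \<le> inner_integral H K y"
    unfolding inner_integral_def set_lebesgue_integral_def
    using y by (intro Bochner_Integration.integral_nonneg) (auto simp: indicator_def chain_density_nonneg[OF H])
  have "inner_integral H K y \<le> (LINT z:?I|interval_measure K. M / y)"
    unfolding inner_integral_def
  proof (rule set_integral_mono)
    show "set_integrable (interval_measure K) ?I (\<lambda>z. chain_density \<Psi> \<psi> H z / z)"
      by (rule set_integrable_chain_density[OF H K y]) auto
    show "set_integrable (interval_measure K) ?I (\<lambda>z. M / y)"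
      unfolding set_integrable_def
      by (rule integrable_const_bound[where B="\<bar>M / y\<bar>"]) (auto simp: indicator_def intro!: AE_I2)
    show "chain_density \<Psi> \<psi> H z / z \<le> M / y" if "z \<in> ?I" for z
      using that y M0 chain_density_le[OF H M] by (intro frac_le) auto
  qed
  also have "\<dots> = measure (interval_measure K) ?I * (M / y)"
    by (subst set_integral_const) auto
  also have "\<dots> \<le> 1 * (M / y)"
    using emeasure_subdf_le_1[OF K, of ?I] M0 y
    by (intro mult_right_mono) (auto simp: emeasure_eq_measure)
  finally show "inner_integral H K y \<le> M / y" by simp
qed

lemma inner_integral_split:
  assumes H: "subdf H" and K: "subdf K" and "0 < y" "y \<le> N"
  shows "inner_integral H K y = (LINT z:{y<..N}|interval_measure K. chain_density \<Psi> \<psi> H z / z) + inner_integral H K N"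
proof -
  have "{y<..} = {y<..N} \<union> {N<..}" using assms by auto
  moreover have "(LINT z:{y<..N} \<union> {N<..}|interval_measure K. chain_density \<Psi> \<psi> H z / z) =
    (LINT z:{y<..N}|interval_measure K. chain_density \<Psi> \<psi> H z / z) +
    (LINT z:{N<..}|interval_measure K. chain_density \<Psi> \<psi> H z / z)"
    using assms by (intro set_integral_Un set_integrable_chain_density[OF H K, of y]) auto
  ultimately show ?thesis by (simp add: inner_integral_def)
qed

text \<open>All integrals are compared with sums over one grid on [y,N] whose coefficients come from
  \<open>H\<close> alone, so convergence at finitely many points is enough.\<close>

lemma inner_integral_tendsto:
  assumes H: "subdf H" and K: "subdf K" and Hn: "\<And>n. subdf (Hn n)" and Kn: "\<And>n. subdf (Kn n)"
    and cont: "\<And>x. x > 0 \<Longrightarrow> isCont H x"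
    and Hlim: "\<And>x. x > 0 \<Longrightarrow> (\<lambda>n. Hn n x) \<longlonglongrightarrow> H x"
    and Klim: "\<And>x. x > 0 \<Longrightarrow> (\<lambda>n. Kn n x) \<longlonglongrightarrow> K x"
    and y: "y > 0"
  shows "(\<lambda>n. inner_integral (Hn n) (Kn n) y) \<longlonglongrightarrow> inner_integral H K y"
proof (rule tendstoI)
  fix e :: real assume e: "e > 0"
  obtain M where M: "M > 0" "\<And>p q. \<lbrakk>0 \<le> p; p \<le> q; q \<le> 1\<rbrakk> \<Longrightarrow> slope \<Psi> \<psi> p q \<le> M"
    using slope_bounded by metis
  \<comment> \<open>The part beyond \<open>N\<close> is at most \<open>M / N\<close>; the summand
    \<open>6 * M / e\<close> makes this at most \<open>e / 6\<close>, and adding \<open>y\<close>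
    puts \<open>N\<close> to the right of \<open>y\<close>.\<close>
  define N where "N = y + 6 * M / e"
  have N: "N > y" "M / N \<le> e / 6"
  proof -
    show "N > y" using M e by (simp add: N_def)
    have "0 < 6 * M / e" using M e by simp
    then have "M / N \<le> M / (6 * M / e)" using M y by (intro frac_le) (auto simp: N_def)
    then show "M / N \<le> e / 6" using M by simp
  qed
  have \<psi>: "0 \<le> \<psi> r" "\<psi> r \<le> M" if "r \<in> {0..1}" for r
    using slope_nonneg[of r r] M(2)[of r r] that by (auto simp: slope_def)
  have "y * e / 12 > 0" using y e by simp
  then obtain d1 where d1: "d1 > 0"
    "\<And>p q r. \<lbrakk>0 \<le> p; p \<le> q; q \<le> 1; r \<in> {0..1}; \<bar>p - r\<bar> < d1; \<bar>q - r\<bar> < d1\<rbrakk> \<Longrightarrow> \<bar>slope \<Psi> \<psi> p q - \<psi> r\<bar> < y * e / 12"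
    using slope_near_diagonal by metis
  have "continuous_on {y..N} H" using cont y by (auto intro!: continuous_at_imp_continuous_on)
  then have "uniformly_continuous_on {y..N} H" by (simp add: compact_uniformly_continuous)
  then obtain d2 where d2: "d2 > 0"
    "\<And>u v. \<lbrakk>u \<in> {y..N}; v \<in> {y..N}; \<bar>u - v\<bar> < d2\<rbrakk> \<Longrightarrow> \<bar>H u - H v\<bar> < d1 / 2"
    using d1(1) unfolding uniformly_continuous_on_def dist_real_def by (metis half_gt_zero)
  \<comment> \<open>\<open>d2\<close> controls the oscillation of \<open>H\<close> on a cell. The
    other term limits the change of 1/z there, at most \<open>d / y^2\<close>, so that it costs at
    most \<open>e / 12\<close> after multiplication by \<open>M\<close>.\<close>
  define d where "d = min d2 (y\<^sup>2 * e / (12 * M))"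
  have d: "d > 0" using d2 y e M by (simp add: d_def)
  obtain k :: nat where k: "(N - y) / d < real k" using reals_Archimedean2 by blast
  have k0: "k > 0" using k N d by (cases k) (auto simp: field_simps)
  define h where "h = (N - y) / real k"
  have h: "h > 0" "h < d" using N k k0 d by (auto simp: h_def field_simps)
  define x where "x i = y + real i * h" for i
  have x: "mono x" "x 0 = y" "x k = N" "\<And>i. x (Suc i) = x i + h"
    using h(1) k0 by (auto simp: x_def mono_def algebra_simps) (simp add: h_def)
  have xy: "y \<le> x i" for i using h by (simp add: x_def)
  have xN: "x i \<le> N" if "i \<le> k" for i using x that by (auto simp: mono_def)
  \<comment> \<open>The coefficients do not depend on \<open>n\<close>: one family approximates
    every integral, and convergence of the sums is convergence of finitely many values of
    \<open>Kn\<close>.\<close>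
  define c where "c i = \<psi> (H (x i)) / x i" for i
  \<comment> \<open>Closeness of \<open>L\<close> to \<open>H\<close> is asked only at grid points.
    Monotonicity traps \<open>L\<close> and its left limits inside a cell between two grid values,
    hence within \<open>d1 / 2 + d1 / 2\<close> of \<open>H (x i)\<close>.\<close>
  have approx: "\<bar>(LINT z:{y<..N}|interval_measure K'. chain_density \<Psi> \<psi> L z / z)
        - (\<Sum>i<k. c i * (K' (x (Suc i)) - K' (x i)))\<bar> \<le> e / 6"
    if L: "subdf L" and K': "subdf K'" and close: "\<And>i. i \<le> k \<Longrightarrow> \<bar>L (x i) - H (x i)\<bar> < d1 / 2" for L K'
  proof -
    note [measurable] = chain_density_measurable[OF L]
    have "\<bar>chain_density \<Psi> \<psi> L z / z - c i\<bar> \<le> e / 6" if i: "i < k" "x i < z" "z \<le> x (Suc i)" for i z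
    proof -
      define p where "p = L z - measure (interval_measure L) {z}"
      have z: "y < z" "0 < z" using xy[of i] i y by auto
      have p: "0 \<le> p" "p \<le> L z" "L z \<le> 1" "L (x i) \<le> p" "L z \<le> L (x (Suc i))"
        using subdf_left_limit_bounds[OF L, of z] subdf_left_limit_ge[OF L i(2)] subdf_le_1[OF L]
          subdf_mono[OF L i(3)] by (auto simp: p_def)
      have Hx: "\<bar>H (x (Suc i)) - H (x i)\<bar> < d1 / 2"
        using xy[of i] xy[of "Suc i"] xN[of "Suc i"] xN[of i] i h x(4)[of i] by (intro d2(2)) (auto simp: d_def)
      have "\<bar>p - H (x i)\<bar> < d1" "\<bar>L z - H (x i)\<bar> < d1"
        using p Hx close[OF less_imp_le[OF i(1)]] close[OF Suc_leI[OF i(1)]] by linarith+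
      then have 1: "\<bar>chain_density \<Psi> \<psi> L z - \<psi> (H (x i))\<bar> < y * e / 12"
        unfolding chain_density_def p_def[symmetric]
        using p subdf_nonneg[OF H] subdf_le_1[OF H] by (intro d1(2)) auto
      have "\<bar>chain_density \<Psi> \<psi> L z / z - \<psi> (H (x i)) / z\<bar> = \<bar>chain_density \<Psi> \<psi> L z - \<psi> (H (x i))\<bar> / z"
        using z by (simp flip: diff_divide_distrib)
      also have "\<dots> \<le> (y * e / 12) / y" using 1 z y e by (intro frac_le) auto
      finally have 2: "\<bar>chain_density \<Psi> \<psi> L z / z - \<psi> (H (x i)) / z\<bar> \<le> e / 12" using y by simp
      have xi: "x i > 0" using xy[of i] y by simp
      have "\<bar>\<psi> (H (x i)) / z - c i\<bar> = \<psi> (H (x i)) * (z - x i) / (z * x i)"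
      proof -
        have "\<psi> (H (x i)) / z - c i = - (\<psi> (H (x i)) * (z - x i) / (z * x i))"
          using z xi by (simp add: c_def field_simps)
        moreover have "0 \<le> \<psi> (H (x i)) * (z - x i) / (z * x i)"
          using z xi i \<psi>(1)[of "H (x i)"] subdf_nonneg[OF H] subdf_le_1[OF H]
          by (intro divide_nonneg_pos mult_nonneg_nonneg) auto
        ultimately show ?thesis by linarith
      qed
      also have "\<dots> \<le> M * d / (y * y)"
        using \<psi>[of "H (x i)"] subdf_nonneg[OF H] subdf_le_1[OF H] z xi xy[of i] y i x(4)[of i] h M
        by (intro frac_le mult_mono) auto
      also have "\<dots> \<le> M * (y\<^sup>2 * e / (12 * M)) / (y * y)"
        using M y by (intro divide_right_mono mult_left_mono) (auto simp: d_def)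
      also have "\<dots> = e / 12" using M y by (simp add: power2_eq_square)
      finally show ?thesis using 2 by linarith
    qed
    then have "\<bar>(LINT z:{x 0<..x k}|interval_measure K'. chain_density \<Psi> \<psi> L z / z)
        - (\<Sum>i<k. c i * (K' (x (Suc i)) - K' (x i)))\<bar> \<le> e / 6 * (K' (x k) - K' (x 0))"
      by (intro stieltjes_riemann_sum(2) K' x) auto
    also have "\<dots> \<le> e / 6 * 1"
      using e subdf_nonneg[OF K', of "x 0"] subdf_le_1[OF K', of "x k"] by (intro mult_left_mono) auto
    finally show ?thesis by (simp add: x)
  qed
  have tail: "\<bar>inner_integral L K' y - (LINT z:{y<..N}|interval_measure K'. chain_density \<Psi> \<psi> L z / z)\<bar> \<le> e / 6"
    if "subdf L" "subdf K'" for L K'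
    using inner_integral_split[OF that y, of N] inner_integral_bounds(1)[OF that _ M(2), of N]
      order_trans[OF inner_integral_bounds(2)[OF that _ M(2), of N] N(2)] N(1) y by auto
  have "\<forall>\<^sub>F n in sequentially. \<forall>i\<in>{..k}. \<bar>Hn n (x i) - H (x i)\<bar> < d1 / 2"
  proof (rule eventually_ball_finite)
    show "\<forall>i\<in>{..k}. \<forall>\<^sub>F n in sequentially. \<bar>Hn n (x i) - H (x i)\<bar> < d1 / 2"
      using tendstoD[OF Hlim, of _ "d1 / 2"] xy y d1(1) by (auto simp: dist_real_def intro: less_le_trans)
  qed simp
  moreover have "(\<lambda>n. \<Sum>i<k. c i * (Kn n (x (Suc i)) - Kn n (x i))) \<longlonglongrightarrow> (\<Sum>i<k. c i * (K (x (Suc i)) - K (x i)))"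
    using xy y by (intro tendsto_intros Klim) (auto intro: less_le_trans)
  then have "\<forall>\<^sub>F n in sequentially. \<bar>(\<Sum>i<k. c i * (Kn n (x (Suc i)) - Kn n (x i))) - (\<Sum>i<k. c i * (K (x (Suc i)) - K (x i)))\<bar> < e / 6"
    using tendstoD[of _ _ _ "e / 6"] e by (fastforce simp: dist_real_def)
  ultimately show "\<forall>\<^sub>F n in sequentially. dist (inner_integral (Hn n) (Kn n) y) (inner_integral H K y) < e"
  proof eventually_elim
    case (elim n)
    have 1: "\<bar>(LINT z:{y<..N}|interval_measure (Kn n). chain_density \<Psi> \<psi> (Hn n) z / z)
        - (\<Sum>i<k. c i * (Kn n (x (Suc i)) - Kn n (x i)))\<bar> \<le> e / 6"
      using elim by (intro approx Hn Kn) auto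
    have 2: "\<bar>(LINT z:{y<..N}|interval_measure K. chain_density \<Psi> \<psi> H z / z)
        - (\<Sum>i<k. c i * (K (x (Suc i)) - K (x i)))\<bar> \<le> e / 6"
      using d1 by (intro approx H K) auto
    \<comment> \<open>Two tails, two Riemann sum errors and the difference of the two sums: five
      terms of at most \<open>e / 6\<close>.\<close>
    show ?case
      using 1 2 elim(2) tail[OF Hn Kn, of n n] tail[OF H K] e unfolding dist_real_def by linarith
  qed
qed

end

subsection \<open>Measurability in time\<close>

lemma subdf_extend:
  assumes "F \<in> subdistribution_functions"
  shows "subdf (\<lambda>x. F (max 0 x))"
  unfolding subdf_def
proof (intro conjI allI)
  have F: "cadlag_on_nonneg F" "mono_on {0..} F" "F ` {0..} \<subseteq> {0..1}"
    using assms by (auto simp: subdistribution_functions_def)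
  show "mono (\<lambda>x. F (max 0 x))"
    using F(2) by (auto simp: mono_on_def intro!: monoI)
  show "range (\<lambda>x. F (max 0 x)) \<subseteq> {0..1}" using F(3) by auto
  show "continuous (at_right x) (\<lambda>x. F (max 0 x))" for x
  proof (cases "x < 0")
    case True
    have "\<forall>\<^sub>F y in at_right x. F (max 0 y) = F 0"
      using eventually_at_right_less[of x] eventually_at_right_real[OF True]
      by eventually_elim auto
    then show ?thesis
      using True by (auto simp: continuous_within intro: tendsto_eventually)
  next
    case False
    then have "(F \<longlongrightarrow> F x) (at_right x)"
      using F(1) by (simp add: cadlag_on_nonneg_def continuous_within)
    moreover have "\<forall>\<^sub>F y in at_right x. F y = F (max 0 y)"
      using eventually_at_right_less[of x] by eventually_elim (use False in auto)
    ultimately show ?thesis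
      using False by (auto simp: continuous_within max_def intro: Lim_transform_eventually)
  qed
qed

lemma space_subdistribution_borel: "space subdistribution_borel = subdistribution_functions"
  unfolding subdistribution_borel_def by (rule space_measure_of) auto

text \<open>The terms are nonnegative and dominated by a geometric series, so the sum is genuine and
  at least each term. A small distance thus forces a small integral on each fixed interval.\<close>

lemma L1_loc_dist_term_le:
  "min ((1 / 2) ^ Suc k) (LINT x:{0..real (Suc k)}|lborel. \<bar>f x - g x\<bar>) \<le> L1_loc_dist f g"
proof -
  let ?a = "\<lambda>k. min ((1 / 2) ^ Suc k) (LINT x:{0..real (Suc k)}|lborel. \<bar>f x - g x\<bar>) :: real"
  have nonneg: "0 \<le> ?a k" for k
    by (auto simp: set_lebesgue_integral_def intro!: Bochner_Integration.integral_nonneg)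
  have "summable (\<lambda>k. (1 / 2) ^ Suc k :: real)"
    by (intro summable_ignore_initial_segment[where k=1, simplified] summable_geometric) auto
  then have "summable ?a"
    by (rule summable_comparison_test') (use nonneg in auto)
  from sum_le_suminf[OF this, of "{k}"] nonneg show ?thesis
    by (simp add: L1_loc_dist_def)
qed

text \<open>Evaluation at a point is upper semicontinuous for the \<open>L1_loc\<close> distance: \<open>f x < a\<close> forces
  \<open>f \<le> a - \<eta>\<close> on some \<open>[x, x + \<delta>]\<close>, and \<open>g x \<ge> a\<close> would put \<open>g\<close> at distance \<open>\<eta> \<delta>\<close> at least.\<close>

lemma measurable_eval_subdistribution:
  assumes x: "x \<ge> 0"
  shows "(\<lambda>f. f x) \<in> borel_measurable subdistribution_borel"
  unfolding borel_measurable_iff_less space_subdistribution_borel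
proof (intro allI)
  fix a :: real
  let ?D = subdistribution_functions
  have "\<exists>e>0. \<forall>g\<in>?D. L1_loc_dist f g < e \<longrightarrow> g x < a" if f: "f \<in> ?D" and fa: "f x < a" for f
  proof -
    have "(f \<longlongrightarrow> f x) (at_right x)"
      using f x by (auto simp: subdistribution_functions_def cadlag_on_nonneg_def continuous_within)
    then have "\<forall>\<^sub>F y in at_right x. f y < a" using fa by (rule order_tendstoD)
    then obtain b where b: "b > x" "\<And>y. x < y \<Longrightarrow> y < b \<Longrightarrow> f y < a"
      by (auto simp: eventually_at_right_field)
    define d where "d = (b - x) / 2"
    have d: "d > 0" "f (x + d) < a" using b by (auto simp: d_def field_simps)
    define \<eta> where "\<eta> = a - f (x + d)"
    have \<eta>: "\<eta> > 0" using d by (simp add: \<eta>_def)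
    obtain k0 where "x + d \<le> real k0" using real_arch_simple by blast
    then obtain k where k: "x + d \<le> real (Suc k)" by (meson less_imp_of_nat_less lessI less_imp_le order_trans)
    \<comment> \<open>The \<open>k\<close>-th summand of the distance is capped at
      \<open>(1 / 2) ^ Suc k\<close>, so \<open>e\<close> may exceed neither this cap nor the area
      \<open>d * \<eta>\<close>.\<close>
    define e where "e = min ((1 / 2) ^ Suc k) (d * \<eta>)"
    have "g x < a" if g: "g \<in> ?D" and dist: "L1_loc_dist f g < e" for g
    proof (rule ccontr)
      assume "\<not> g x < a"
      then have ga: "a \<le> g x" by simp
      let ?I = "{0..real (Suc k)}"
      have fL: "set_integrable lborel ?I f" and gL: "set_integrable lborel ?I g"
        and fm: "mono_on {0..} f" and gm: "mono_on {0..} g"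
        using f g by (auto simp: subdistribution_functions_def L1_loc_def simp del: of_nat_Suc)
      have "set_integrable lborel ?I (\<lambda>y. \<bar>f y - g y\<bar>)"
        by (intro set_integrable_abs set_integral_diff fL gL)
      then have int: "integrable lborel (\<lambda>y. indicat_real ?I y *\<^sub>R \<bar>f y - g y\<bar>)"
        by (simp add: set_integrable_def)
      have "indicat_real {x..x + d} y * \<eta> \<le> indicat_real ?I y *\<^sub>R \<bar>f y - g y\<bar>" for y
      proof (cases "y \<in> {x..x + d}")
        case True
        then have "f y \<le> f (x + d)" "g x \<le> g y"
          using x by (auto intro!: mono_onD[OF fm] mono_onD[OF gm])
        then show ?thesis using True k x ga by (auto simp: \<eta>_def indicator_def)
      qed (auto simp: indicator_def)
      then have "(\<integral>y. indicat_real {x..x + d} y * \<eta> \<partial>lborel) \<le> (LINT y:?I|lborel. \<bar>f y - g y\<bar>)"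
        unfolding set_lebesgue_integral_def using d
          by (intro integral_mono int integrable_mult_left integrable_real_indicator) auto
      moreover have "(\<integral>y. indicat_real {x..x + d} y * \<eta> \<partial>lborel) = d * \<eta>"
        using d by simp
      ultimately have "e \<le> L1_loc_dist f g"
        using L1_loc_dist_term_le[of k f g] unfolding e_def by linarith
      then show False using dist by simp
    qed
    moreover have "e > 0" using d \<eta> by (simp add: e_def)
    ultimately show ?thesis by blast
  qed
  \<comment> \<open>The sublevel set has just been shown to be open, so it is one of the
    generators.\<close>
  then show "{f \<in> ?D. f x < a} \<in> sets subdistribution_borel"
    unfolding subdistribution_borel_def
    by (subst sets_measure_of) (auto intro!: sigma_sets.Basic)
qed

text \<open>Freezing both arguments below 0 makes a path total: every slice becomes a
  \<open>subdf\<close> and the map is Borel on the whole plane. For \<open>u \<ge> 0\<close> the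
  interval measure of the slice is \<open>stieltjes (F u)\<close>.\<close>

definition extend_path :: "(real \<Rightarrow> real \<Rightarrow> real) \<Rightarrow> real \<Rightarrow> real \<Rightarrow> real" where
  "extend_path F u x = F (max 0 u) (max 0 x)"

lemma subdf_extend_path:
  assumes "F \<in> subdistribution_paths"
  shows "subdf (extend_path F u)"
proof -
  have "F (max 0 u) \<in> subdistribution_functions"
    using assms measurable_space[of F "restrict_space borel {0..}" subdistribution_borel "max 0 u"]
    by (auto simp: subdistribution_paths_def space_subdistribution_borel space_restrict_space)
  from subdf_extend[OF this] show ?thesis by (simp add: extend_path_def[abs_def])
qed

text \<open>Right continuity in \<open>x\<close> upgrades measurability in \<open>u\<close> at each
  fixed \<open>x\<close> to joint measurability: rounding \<open>x\<close> up to a grid leaves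
  countably many slices, and the grids are refined.\<close>

lemma measurable_extend_path:
  assumes F: "F \<in> subdistribution_paths"
  shows "(\<lambda>(u, x). extend_path F u x) \<in> borel_measurable (borel \<Otimes>\<^sub>M borel)"
proof -
  have eval: "(\<lambda>u. extend_path F u x) \<in> borel_measurable borel" for x
  proof -
    have "(\<lambda>u. max 0 u) \<in> measurable borel (restrict_space borel {0::real..})"
      by (rule measurable_restrict_space2) auto
    from measurable_compose[OF this F[unfolded subdistribution_paths_def]]
    have "(\<lambda>u. F (max 0 u)) \<in> measurable borel subdistribution_borel" .
    from measurable_compose[OF this measurable_eval_subdistribution[of "max 0 x"]]
    show ?thesis by (simp add: extend_path_def)
  qed
  define r where "r m x = (of_int \<lfloor>x * real (Suc m)\<rfloor> + 1) / real (Suc m)" for m x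
  have r: "x \<le> r m x" "r m x \<le> x + 1 / real (Suc m)" for m x
  proof -
    have "x * real (Suc m) / real (Suc m) \<le> r m x" "r m x \<le> (x * real (Suc m) + 1) / real (Suc m)"
      unfolding r_def by (intro divide_right_mono; linarith)+
    then show "x \<le> r m x" "r m x \<le> x + 1 / real (Suc m)"
      by (simp_all add: add_divide_distrib del: of_nat_Suc)
  qed
  have rlim: "(\<lambda>m. r m x) \<longlonglongrightarrow> x" for x
  proof (rule tendsto_sandwich[of "\<lambda>_. x" _ _ "\<lambda>m. x + 1 / real (Suc m)"])
    show "(\<lambda>m. x + 1 / real (Suc m)) \<longlonglongrightarrow> x" by real_asymp
  qed (use r in auto)
  have "(\<lambda>z. extend_path F (fst z) (snd z)) \<in> borel_measurable (borel \<Otimes>\<^sub>M borel)"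
  proof (rule borel_measurable_LIMSEQ_real)
    fix z :: "real \<times> real"
    show "(\<lambda>m. extend_path F (fst z) (r m (snd z))) \<longlonglongrightarrow> extend_path F (fst z) (snd z)"
      by (rule subdf_tendsto_from_right[OF subdf_extend_path[OF F] rlim r(1)])
  next
    fix m :: nat
    have "(\<lambda>z. (\<lambda>i z. extend_path F (fst z) ((of_int i + 1) / real (Suc m))) \<lfloor>snd z * real (Suc m)\<rfloor> z)
      \<in> borel_measurable (borel \<Otimes>\<^sub>M borel)"
      by (rule measurable_compose_countable[OF measurable_compose[OF measurable_fst eval]]) measurable
    then show "(\<lambda>z. extend_path F (fst z) (r m (snd z))) \<in> borel_measurable (borel \<Otimes>\<^sub>M borel)"
      by (simp add: r_def)
  qed
  then show ?thesis by (simp add: case_prod_beta')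
qed

lemma measurable_interval_measure_kernel:
  assumes \<Phi>: "\<And>u. subdf (\<Phi> u)" and meas: "\<And>x. (\<lambda>u. \<Phi> u x) \<in> borel_measurable M"
  shows "(\<lambda>u. interval_measure (\<Phi> u)) \<in> measurable M (subprob_algebra borel)"
proof (rule measurable_subprob_algebra_generated[where \<Omega>=UNIV and G="range (\<lambda>(a,b). {a<..b::real})"])
  note [measurable] = meas
  show "sets borel = sigma_sets UNIV (range (\<lambda>(a, b). {a<..b::real}))"
    by (simp add: borel_sigma_sets_Ioc)
  show "Int_stable (range (\<lambda>(a, b). {a<..b::real}))"
    by (auto simp: Int_stable_def)
  show "subprob_space (interval_measure (\<Phi> u))" for u by (rule subprob_space_subdf[OF \<Phi>])
  have Ioc: "(\<lambda>u. emeasure (interval_measure (\<Phi> u)) {a<..b}) \<in> borel_measurable M" for a b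
    by (cases "a \<le> b") (simp_all add: emeasure_subdf_Ioc[OF \<Phi>])
  then show "(\<lambda>u. emeasure (interval_measure (\<Phi> u)) A) \<in> borel_measurable M" if "A \<in> range (\<lambda>(a, b). {a<..b})" for A
    using that by auto
  \<comment> \<open>The whole line is not one of the generating intervals; its mass is obtained as
    an increasing limit.\<close>
  have "(\<lambda>u. SUP n::nat. emeasure (interval_measure (\<Phi> u)) {- real n<..real n}) \<in> borel_measurable M"
    using Ioc by measurable
  moreover have "(SUP n::nat. emeasure (interval_measure (\<Phi> u)) {- real n<..real n}) = emeasure (interval_measure (\<Phi> u)) UNIV" for u
    by (subst SUP_emeasure_incseq) (auto simp: incseq_def UN_Ioc_eq_UNIV)
  ultimately show "(\<lambda>u. emeasure (interval_measure (\<Phi> u)) UNIV) \<in> borel_measurable M" by simp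
qed auto

section \<open>The integrand in time: bound and joint measurability\<close>

context C1_unit
begin

text \<open>At \<open>y = exp (s - t) * x\<close> this is the time integrand of
  \<open>C_operator\<close>. The value 0 for \<open>y \<le> 0\<close> agrees with the operator at
  \<open>x = 0\<close>, where the square vanishes, and makes \<open>growth_bound\<close> hold on the
  whole line.\<close>

definition growth :: "(real \<Rightarrow> real \<Rightarrow> real) \<Rightarrow> (real \<Rightarrow> real \<Rightarrow> real) \<Rightarrow> real \<Rightarrow> real \<Rightarrow> real" where
  "growth \<Phi> \<Theta> u y = (if 0 < y then y\<^sup>2 * inner_integral (\<Phi> u) (\<Theta> u) y else 0)"

text \<open>The factor \<open>y^2\<close> absorbs the singular bound \<open>M / y\<close>. The
  constant depends neither on the pair nor on the time, which is what domination requires.\<close>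

lemma growth_bound:
  assumes "subdf (\<Phi> u)" "subdf (\<Theta> u)" "\<And>p q. \<lbrakk>0 \<le> p; p \<le> q; q \<le> 1\<rbrakk> \<Longrightarrow> slope \<Psi> \<psi> p q \<le> M"
  shows "\<bar>growth \<Phi> \<Theta> u y\<bar> \<le> M * \<bar>y\<bar>"
proof (cases "0 < y")
  case True
  have "y\<^sup>2 * inner_integral (\<Phi> u) (\<Theta> u) y \<le> y\<^sup>2 * (M / y)"
    by (intro mult_left_mono inner_integral_bounds(2) assms True) auto
  also have "\<dots> = M * y" using True by (simp add: power2_eq_square)
  finally show ?thesis
    using True inner_integral_bounds(1)[OF assms(1,2) True assms(3)] by (simp add: growth_def)
next
  case False
  then show ?thesis using order_trans[OF slope_nonneg[of 0 0] assms(3)[of 0 0]]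
    by (auto simp: growth_def intro: mult_nonneg_nonpos)
qed

text \<open>The integrating measure varies with \<open>u\<close>, so it has to be a measurable
  kernel. As the integrand is nonnegative for \<open>y > 0\<close>, the question can be moved to
  \<open>nn_integral\<close>.\<close>

lemma measurable_growth:
  assumes \<Phi>: "\<And>u. subdf (\<Phi> u)" and \<Theta>: "\<And>u. subdf (\<Theta> u)"
    and \<Phi>m: "(\<lambda>(u, x). \<Phi> u x) \<in> borel_measurable (borel \<Otimes>\<^sub>M borel)"
    and \<Theta>m: "(\<lambda>(u, x). \<Theta> u x) \<in> borel_measurable (borel \<Otimes>\<^sub>M borel)"
  shows "(\<lambda>(u, y). growth \<Phi> \<Theta> u y) \<in> borel_measurable (borel \<Otimes>\<^sub>M borel)"
proof -
  have [measurable]: "(\<lambda>z. \<Phi> (fst z) (snd z)) \<in> borel_measurable (borel \<Otimes>\<^sub>M borel)"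
    "(\<lambda>z. \<Theta> (fst z) (snd z)) \<in> borel_measurable (borel \<Otimes>\<^sub>M borel)"
    using \<Phi>m \<Theta>m by (simp_all add: case_prod_beta')
  have [measurable]: "(\<lambda>z. chain_density \<Psi> \<psi> (\<Phi> (fst z)) (snd z)) \<in> borel_measurable (borel \<Otimes>\<^sub>M borel)"
  proof (rule borel_measurable_LIMSEQ_real)
    fix z :: "real \<times> real"
    show "(\<lambda>m. slope \<Psi> \<psi> (\<Phi> (fst z) (snd z - 1 / real (Suc m))) (\<Phi> (fst z) (snd z)))
        \<longlonglongrightarrow> chain_density \<Psi> \<psi> (\<Phi> (fst z)) (snd z)"
    proof (intro chain_density_tendsto \<Phi>)
      show "(\<lambda>m. snd z - 1 / real (Suc m)) \<longlonglongrightarrow> snd z" by real_asymp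
    qed auto
  next
    fix m :: nat
    \<comment> \<open>Written as a composition with a pair map, so that the declared measurability
      of \<open>\<Phi> (fst z) (snd z)\<close> matches.\<close>
    have "(\<lambda>z. \<Phi> (fst (fst z, snd z - 1 / real (Suc m))) (snd (fst z, snd z - 1 / real (Suc m)))) \<in> borel_measurable (borel \<Otimes>\<^sub>M borel)"
      by measurable
    then have "(\<lambda>z. \<Phi> (fst z) (snd z - 1 / real (Suc m))) \<in> borel_measurable (borel \<Otimes>\<^sub>M borel)"
      by simp
    then show "(\<lambda>z. slope \<Psi> \<psi> (\<Phi> (fst z) (snd z - 1 / real (Suc m))) (\<Phi> (fst z) (snd z))) \<in> borel_measurable (borel \<Otimes>\<^sub>M borel)"
      by (rule slope_measurable) (auto simp: subdf_nonneg subdf_le_1 subdf_mono \<Phi>)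
  qed
  have \<Theta>x: "(\<lambda>u. \<Theta> u x) \<in> borel_measurable borel" for x
  proof -
    have "(\<lambda>u. \<Theta> (fst (u, x)) (snd (u, x))) \<in> borel_measurable borel" by measurable
    then show ?thesis by simp
  qed
  have kernel: "(\<lambda>w. interval_measure (\<Theta> (fst w))) \<in> measurable (borel \<Otimes>\<^sub>M borel) (subprob_algebra borel)"
    by (rule measurable_compose[OF measurable_fst measurable_interval_measure_kernel[OF \<Theta> \<Theta>x]])
  define J where "J w z = ennreal (indicat_real {snd w<..} z * (chain_density \<Psi> \<psi> (\<Phi> (fst w)) z / z))" for w :: "real \<times> real" and z
  have "(\<lambda>p. ennreal ((if snd (fst p) < snd p then 1 else 0) *
      (chain_density \<Psi> \<psi> (\<Phi> (fst (fst (fst p), snd p))) (snd (fst (fst p), snd p)) / snd p)))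
      \<in> borel_measurable ((borel \<Otimes>\<^sub>M borel) \<Otimes>\<^sub>M borel)"
    by measurable
  then have "(\<lambda>(w, z). J w z) \<in> borel_measurable ((borel \<Otimes>\<^sub>M borel) \<Otimes>\<^sub>M borel)"
    by (simp add: J_def case_prod_beta' indicator_def of_bool_def)
  from nn_integral_measurable_subprob_algebra2[OF this kernel]
  have [measurable]: "(\<lambda>w. \<integral>\<^sup>+z. J w z \<partial>interval_measure (\<Theta> (fst w))) \<in> borel_measurable (borel \<Otimes>\<^sub>M borel)" .
  have "inner_integral (\<Phi> u) (\<Theta> u) y = enn2real (\<integral>\<^sup>+z. J (u, y) z \<partial>interval_measure (\<Theta> u))" if "0 < y" for u y
    unfolding inner_integral_def set_lebesgue_integral_def J_def
    using that chain_density_measurable[OF \<Phi>, of u]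
    by (subst integral_eq_nn_integral) (auto simp: indicator_def chain_density_nonneg[OF \<Phi>])
  then have "growth \<Phi> \<Theta> (fst w) (snd w) =
      (if 0 < snd w then (snd w)\<^sup>2 * enn2real (\<integral>\<^sup>+z. J w z \<partial>interval_measure (\<Theta> (fst w))) else 0)" for w
    by (simp add: growth_def)
  then show ?thesis by (simp add: case_prod_beta')
qed

end

subsection \<open>Convergence of the operator\<close>

text \<open>Since \<open>c \<le> 1\<close>, the substitution \<open>y = c * x\<close> maps [0,k]
  into itself, and only the Jacobian \<open>1 / c\<close> is lost.\<close>

lemma nn_integral_Icc_scale_le:
  fixes f :: "real \<Rightarrow> ennreal"
  assumes f[measurable]: "f \<in> borel_measurable borel" and c: "0 < c" "c \<le> 1" "1 / c \<le> C"
  shows "(\<integral>\<^sup>+x\<in>{0..k}. f (c * x) \<partial>lborel) \<le> ennreal C * (\<integral>\<^sup>+y\<in>{0..k}. f y \<partial>lborel)"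
proof -
  let ?g = "\<lambda>y. f y * indicator {0..k} y"
  have "(\<integral>\<^sup>+x\<in>{0..k}. f (c * x) \<partial>lborel) \<le> (\<integral>\<^sup>+x. ?g (c * x) \<partial>lborel)"
  proof (intro nn_integral_mono)
    fix x
    have "c * x \<le> k" if "0 \<le> x" "x \<le> k"
      using mult_left_le_one_le[of x c] c that by simp
    then show "f (c * x) * indicator {0..k} x \<le> ?g (c * x)"
      using c by (auto simp: indicator_def)
  qed
  also have "\<dots> = ennreal (1 / c) * (ennreal c * (\<integral>\<^sup>+x. ?g (0 + c * x) \<partial>lborel))"
    using c by (simp add: mult.assoc[symmetric] ennreal_mult[symmetric])
  also have "\<dots> = ennreal (1 / c) * (\<integral>\<^sup>+y. ?g y \<partial>lborel)"
    using c nn_integral_real_affine[of ?g c 0] by simp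
  also have "\<dots> \<le> ennreal C * (\<integral>\<^sup>+y. ?g y \<partial>lborel)"
    by (intro mult_right_mono ennreal_leI c) simp
  finally show ?thesis .
qed

lemma borel_measurable_curry:
  assumes "(\<lambda>(u, y). h u y) \<in> borel_measurable (borel \<Otimes>\<^sub>M borel)"
    and f: "f \<in> borel_measurable M" and g: "g \<in> borel_measurable M"
  shows "(\<lambda>z. h (f z) (g z)) \<in> borel_measurable M"
  using measurable_compose[OF measurable_Pair[OF f g] assms(1)] by simp

lemma set_integrable_transport:
  fixes h :: "real \<Rightarrow> real \<Rightarrow> real"
  assumes h: "(\<lambda>(u, y). h u y) \<in> borel_measurable (borel \<Otimes>\<^sub>M borel)"
    and bound: "\<And>u y. \<bar>h u y\<bar> \<le> M * \<bar>y\<bar>"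
  shows "set_integrable lborel {0..s} (\<lambda>u. h u (exp (u - s) * x))"
  unfolding set_integrable_def
proof (rule integrableI_bounded_set[where A="{0..s}" and B="M * \<bar>x\<bar>"])
  have M: "0 \<le> M" using bound[of 0 1] by simp
  show "(\<lambda>u. indicat_real {0..s} u *\<^sub>R h u (exp (u - s) * x)) \<in> borel_measurable lborel"
    by (intro borel_measurable_scaleR borel_measurable_curry[OF h]) auto
  have "norm (indicat_real {0..s} u *\<^sub>R h u (exp (u - s) * x)) \<le> M * \<bar>x\<bar>" if "u \<in> {0..s}" for u
  proof -
    have "exp (u - s) * \<bar>x\<bar> \<le> 1 * \<bar>x\<bar>" using that by (intro mult_right_mono) auto
    then have "M * \<bar>exp (u - s) * x\<bar> \<le> M * \<bar>x\<bar>"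
      using M by (intro mult_left_mono) (auto simp: abs_mult)
    with bound[of u "exp (u - s) * x"] that show ?thesis by simp
  qed
  then show "AE u in lborel. u \<in> {0..s} \<longrightarrow> norm (indicat_real {0..s} u *\<^sub>R h u (exp (u - s) * x)) \<le> M * \<bar>x\<bar>"
    by simp
qed (auto simp: indicator_def emeasure_lborel_Icc_eq)

text \<open>After Tonelli, each fixed \<open>u\<close> is treated by the substitution
  \<open>y = exp (u - s) * x\<close>, whose Jacobian is at most \<open>exp t\<close>. The bound is
  free of \<open>s\<close> and therefore controls a supremum over \<open>s\<close>.\<close>

lemma transport_diff_le:
  fixes h1 h2 :: "real \<Rightarrow> real \<Rightarrow> real"
  assumes h1: "(\<lambda>(u, y). h1 u y) \<in> borel_measurable (borel \<Otimes>\<^sub>M borel)"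
    and h2: "(\<lambda>(u, y). h2 u y) \<in> borel_measurable (borel \<Otimes>\<^sub>M borel)"
    and bound: "\<And>u y. \<bar>h1 u y\<bar> \<le> M * \<bar>y\<bar>" "\<And>u y. \<bar>h2 u y\<bar> \<le> M * \<bar>y\<bar>"
    and s: "0 \<le> s" "s \<le> t"
  shows "(\<integral>\<^sup>+x\<in>{0..k}. ennreal \<bar>(LINT u:{0..s}|lborel. h1 u (exp (u - s) * x))
        - (LINT u:{0..s}|lborel. h2 u (exp (u - s) * x))\<bar> \<partial>lborel)
    \<le> ennreal (exp t) * (\<integral>\<^sup>+u\<in>{0..t}. (\<integral>\<^sup>+y\<in>{0..k}. ennreal \<bar>h1 u y - h2 u y\<bar> \<partial>lborel) \<partial>lborel)"
proof -
  note [measurable] = borel_measurable_curry[OF h1] borel_measurable_curry[OF h2]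
  let ?D = "\<lambda>u y. ennreal \<bar>h1 u y - h2 u y\<bar>"
  have "(\<integral>\<^sup>+x\<in>{0..k}. ennreal \<bar>(LINT u:{0..s}|lborel. h1 u (exp (u - s) * x))
        - (LINT u:{0..s}|lborel. h2 u (exp (u - s) * x))\<bar> \<partial>lborel)
    \<le> (\<integral>\<^sup>+x. (\<integral>\<^sup>+u. ?D u (exp (u - s) * x) * indicator {0..s} u * indicator {0..k} x \<partial>lborel) \<partial>lborel)"
  proof (intro nn_integral_mono)
    fix x
    have i: "set_integrable lborel {0..s} (\<lambda>u. h1 u (exp (u - s) * x))" "set_integrable lborel {0..s} (\<lambda>u. h2 u (exp (u - s) * x))"
      using set_integrable_transport[OF h1 bound(1)] set_integrable_transport[OF h2 bound(2)] by auto
    then have "(LINT u:{0..s}|lborel. h1 u (exp (u - s) * x)) - (LINT u:{0..s}|lborel. h2 u (exp (u - s) * x))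
      = (LINT u:{0..s}|lborel. h1 u (exp (u - s) * x) - h2 u (exp (u - s) * x))"
      by (simp add: set_integral_diff)
    moreover have "ennreal \<bar>LINT u:{0..s}|lborel. h1 u (exp (u - s) * x) - h2 u (exp (u - s) * x)\<bar>
      \<le> (\<integral>\<^sup>+u. norm (indicat_real {0..s} u *\<^sub>R (h1 u (exp (u - s) * x) - h2 u (exp (u - s) * x))) \<partial>lborel)"
      using integral_norm_bound_ennreal[OF set_integral_diff(1)[OF i, unfolded set_integrable_def]]
      by (simp add: set_lebesgue_integral_def)
    moreover have "\<dots> = (\<integral>\<^sup>+u. ?D u (exp (u - s) * x) * indicator {0..s} u \<partial>lborel)"
      by (intro nn_integral_cong) (auto simp: indicator_def)
    ultimately show "ennreal \<bar>(LINT u:{0..s}|lborel. h1 u (exp (u - s) * x))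
        - (LINT u:{0..s}|lborel. h2 u (exp (u - s) * x))\<bar> * indicator {0..k} x
      \<le> (\<integral>\<^sup>+u. ?D u (exp (u - s) * x) * indicator {0..s} u * indicator {0..k} x \<partial>lborel)"
      by (auto simp: indicator_def)
  qed
  also have "\<dots> = (\<integral>\<^sup>+u. (\<integral>\<^sup>+x. ?D u (exp (u - s) * x) * indicator {0..s} u * indicator {0..k} x \<partial>lborel) \<partial>lborel)"
    by (rule lborel_pair.Fubini') measurable
  also have "\<dots> \<le> (\<integral>\<^sup>+u. ennreal (exp t) * ((\<integral>\<^sup>+y\<in>{0..k}. ?D u y \<partial>lborel) * indicator {0..t} u) \<partial>lborel)"
  proof (intro nn_integral_mono)
    fix u
    show "(\<integral>\<^sup>+x. ?D u (exp (u - s) * x) * indicator {0..s} u * indicator {0..k} x \<partial>lborel)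
      \<le> ennreal (exp t) * ((\<integral>\<^sup>+y\<in>{0..k}. ?D u y \<partial>lborel) * indicator {0..t} u)"
    proof (cases "u \<in> {0..s}")
      case True
      have "(\<integral>\<^sup>+x\<in>{0..k}. ?D u (exp (u - s) * x) \<partial>lborel) \<le> ennreal (exp t) * (\<integral>\<^sup>+y\<in>{0..k}. ?D u y \<partial>lborel)"
        using True s by (intro nn_integral_Icc_scale_le) (auto simp flip: exp_minus simp: divide_inverse)
      then show ?thesis using True s by (simp add: indicator_def)
    qed simp
  qed
  also have "\<dots> = ennreal (exp t) * (\<integral>\<^sup>+u\<in>{0..t}. (\<integral>\<^sup>+y\<in>{0..k}. ?D u y \<partial>lborel) \<partial>lborel)"
    by (rule nn_integral_cmult) measurable
  finally show ?thesis .
qed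

text \<open>On the rectangle the linear bound becomes a constant, integrable because the area is
  finite, so dominated convergence applies on the product.\<close>

lemma nn_integral_diff_tendsto_0:
  fixes h :: "real \<Rightarrow> real \<Rightarrow> real" and hn :: "nat \<Rightarrow> real \<Rightarrow> real \<Rightarrow> real"
  assumes h: "(\<lambda>(u, y). h u y) \<in> borel_measurable (borel \<Otimes>\<^sub>M borel)"
    and hn: "\<And>n. (\<lambda>(u, y). hn n u y) \<in> borel_measurable (borel \<Otimes>\<^sub>M borel)"
    and bound: "\<And>n u y. \<bar>hn n u y\<bar> \<le> M * \<bar>y\<bar>"
    and lim: "\<And>u y. 0 \<le> u \<Longrightarrow> 0 \<le> y \<Longrightarrow> (\<lambda>n. hn n u y) \<longlonglongrightarrow> h u y"
  shows "(\<lambda>n. \<integral>\<^sup>+u\<in>{0..t}. (\<integral>\<^sup>+y\<in>{0..k}. ennreal \<bar>hn n u y - h u y\<bar> \<partial>lborel) \<partial>lborel) \<longlonglongrightarrow> 0"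
proof -
  note [measurable] = borel_measurable_curry[OF h] borel_measurable_curry[OF hn]
  have M: "0 \<le> M" using bound[of 0 0 1] by simp
  let ?R = "lborel \<Otimes>\<^sub>M (lborel :: real measure)"
  let ?i = "\<lambda>z. indicat_real {0..t} (fst z) * indicat_real {0..k} (snd z)"
  have "(\<lambda>n. \<integral>\<^sup>+z. norm (?i z * h (fst z) (snd z) - ?i z * hn n (fst z) (snd z)) \<partial>?R) \<longlonglongrightarrow> 0"
  proof (rule nn_integral_dominated_convergence_norm[where w="\<lambda>z. ?i z * (M * \<bar>k\<bar>)"])
    show "AE z in ?R. norm (?i z * hn n (fst z) (snd z)) \<le> ?i z * (M * \<bar>k\<bar>)" for n
    proof (rule AE_I2)
      fix z :: "real \<times> real"
      show "norm (?i z * hn n (fst z) (snd z)) \<le> ?i z * (M * \<bar>k\<bar>)"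
        using order_trans[OF bound[of n "fst z" "snd z"] mult_left_mono[OF _ M, of "\<bar>snd z\<bar>" "\<bar>k\<bar>"]]
        by (auto simp: indicator_def)
    qed
    have "(\<integral>\<^sup>+z. ennreal (?i z * (M * \<bar>k\<bar>)) \<partial>?R) =
      (\<integral>\<^sup>+z. ennreal (M * \<bar>k\<bar>) * indicator ({0..t} \<times> {0..k}) z \<partial>?R)"
      by (intro nn_integral_cong) (auto simp: indicator_def)
    also have "\<dots> = ennreal (M * \<bar>k\<bar>) * (emeasure lborel {0..t} * emeasure lborel {0..k})"
      by (simp add: nn_integral_cmult_indicator lborel.emeasure_pair_measure_Times)
    also have "\<dots> < \<infinity>" by (simp add: emeasure_lborel_Icc_eq ennreal_mult_less_top)
    finally show "(\<integral>\<^sup>+z. ennreal (?i z * (M * \<bar>k\<bar>)) \<partial>?R) < \<infinity>" .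
    show "AE z in ?R. (\<lambda>n. ?i z * hn n (fst z) (snd z)) \<longlonglongrightarrow> ?i z * h (fst z) (snd z)"
    proof (rule AE_I2)
      fix z :: "real \<times> real"
      show "(\<lambda>n. ?i z * hn n (fst z) (snd z)) \<longlonglongrightarrow> ?i z * h (fst z) (snd z)"
        using lim[of "fst z" "snd z"] by (auto simp: indicator_def)
    qed
  qed measurable
  moreover have "(\<integral>\<^sup>+z. norm (?i z * h (fst z) (snd z) - ?i z * hn n (fst z) (snd z)) \<partial>?R) =
    (\<integral>\<^sup>+u\<in>{0..t}. (\<integral>\<^sup>+y\<in>{0..k}. ennreal \<bar>hn n u y - h u y\<bar> \<partial>lborel) \<partial>lborel)" for n
  proof -
    have "(\<integral>\<^sup>+z. norm (?i z * h (fst z) (snd z) - ?i z * hn n (fst z) (snd z)) \<partial>?R) =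
      (\<integral>\<^sup>+u. \<integral>\<^sup>+y. norm (?i (u, y) * h (fst (u, y)) (snd (u, y)) - ?i (u, y) * hn n (fst (u, y)) (snd (u, y))) \<partial>lborel \<partial>lborel)"
      by (rule lborel.nn_integral_fst[symmetric]) measurable
    also have "\<dots> = (\<integral>\<^sup>+u\<in>{0..t}. (\<integral>\<^sup>+y\<in>{0..k}. ennreal \<bar>hn n u y - h u y\<bar> \<partial>lborel) \<partial>lborel)"
      by (subst nn_integral_multc[symmetric], measurable, intro nn_integral_cong)
        (auto simp: indicator_def abs_minus_commute)
    finally show ?thesis .
  qed
  ultimately show ?thesis by simp
qed

lemma converges_locally_uniformly_at:
  assumes "converges_locally_uniformly Fn F" "0 \<le> s"
  shows "(\<lambda>n. \<integral>\<^sup>+x\<in>{0..b}. ennreal \<bar>Fn n s x - F s x\<bar> \<partial>lborel) \<longlonglongrightarrow> 0"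
proof (rule tendsto_sandwich[OF _ _ tendsto_const])
  \<comment> \<open>The definition speaks of positive time horizons only; \<open>s + 1\<close>
    covers \<open>s = 0\<close> as well.\<close>
  show "(\<lambda>n. SUP s'\<in>{0..s + 1}. \<integral>\<^sup>+x\<in>{0..b}. ennreal \<bar>Fn n s' x - F s' x\<bar> \<partial>lborel) \<longlonglongrightarrow> 0"
    using assms by (auto simp: converges_locally_uniformly_def)
  show "\<forall>\<^sub>F n in sequentially. (\<integral>\<^sup>+x\<in>{0..b}. ennreal \<bar>Fn n s x - F s x\<bar> \<partial>lborel)
      \<le> (SUP s'\<in>{0..s + 1}. \<integral>\<^sup>+x\<in>{0..b}. ennreal \<bar>Fn n s' x - F s' x\<bar> \<partial>lborel)"
    using assms by (intro always_eventually allI SUP_upper) auto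
qed simp

lemma nn_integral_extend_path:
  assumes "0 \<le> u"
  shows "(\<integral>\<^sup>+x\<in>{0..b}. ennreal \<bar>extend_path F1 u x - extend_path F2 u x\<bar> \<partial>lborel) =
    (\<integral>\<^sup>+x\<in>{0..b}. ennreal \<bar>F1 u x - F2 u x\<bar> \<partial>lborel)"
  using assms by (intro nn_integral_cong) (auto simp: extend_path_def indicator_def max_def)

section \<open>The operator on pairs of paths\<close>

context C1_unit
begin

abbreviation path_growth where
  "path_growth F G \<equiv> growth (extend_path F) (extend_path G)"

lemma measurable_path_growth:
  assumes "(F, G) \<in> ac_path_pairs"
  shows "(\<lambda>(u, y). path_growth F G u y) \<in> borel_measurable (borel \<Otimes>\<^sub>M borel)"
  using assms by (intro measurable_growth) (auto simp: ac_path_pairs_def intro: subdf_extend_path measurable_extend_path)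

lemma path_growth_bound:
  assumes "(F, G) \<in> ac_path_pairs" "\<And>p q. \<lbrakk>0 \<le> p; p \<le> q; q \<le> 1\<rbrakk> \<Longrightarrow> slope \<Psi> \<psi> p q \<le> M"
  shows "\<bar>path_growth F G u y\<bar> \<le> M * \<bar>y\<bar>"
  using assms by (intro growth_bound) (auto simp: ac_path_pairs_def intro: subdf_extend_path)

text \<open>From here on the Radon-Nikodym derivative is gone. At \<open>x = 0\<close> both
  integrands are 0, whatever the inner integral is.\<close>

lemma C_operator_eq:
  assumes FG: "(F, G) \<in> ac_path_pairs" and t: "0 \<le> t" and x: "0 \<le> x"
  shows "C_operator \<Psi> F G t x = extend_path G 0 (exp (- t) * x) +
    (LINT u:{0..t}|lborel. path_growth F G u (exp (u - t) * x))"
proof -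
  have "(exp (u - t) * x)\<^sup>2 * (LINT z:{exp (u - t) * x<..}|stieltjes (\<Psi> \<circ> F u).
      enn2real (RN_deriv (stieltjes (F u)) (stieltjes (G u)) z) / z) = path_growth F G u (exp (u - t) * x)"
    if "u \<in> {0..t}" for u
  proof (cases "x = 0")
    case True
    then show ?thesis by (simp add: growth_def)
  next
    case False
    have st: "stieltjes (F u) = interval_measure (extend_path F u)"
      "stieltjes (G u) = interval_measure (extend_path G u)"
      "stieltjes (\<Psi> \<circ> F u) = interval_measure (\<lambda>x. \<Psi> (extend_path F u x))"
      using that by (simp_all add: stieltjes_def extend_path_def[abs_def] max_def)
    have sub: "subdf (extend_path F u)" "subdf (extend_path G u)"
      using FG by (auto simp: ac_path_pairs_def subdf_extend_path)
    have "absolutely_continuous (interval_measure (extend_path F u)) (interval_measure (extend_path G u))"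
      using FG that by (auto simp: ac_path_pairs_def st[symmetric])
    from integral_RN_deriv_compose[OF sub this] show ?thesis
      unfolding st using x False by (simp add: growth_def inner_integral_def)
  qed
  then show ?thesis
    unfolding C_operator_def using t x
    by (auto simp: extend_path_def intro!: set_lebesgue_integral_cong)
qed

lemma C_operator_L1_loc:
  assumes FG: "(F, G) \<in> ac_path_pairs" and t: "0 \<le> t"
  shows "C_operator \<Psi> F G t \<in> L1_loc"
proof -
  obtain M where M: "M > 0" "\<And>p q. \<lbrakk>0 \<le> p; p \<le> q; q \<le> 1\<rbrakk> \<Longrightarrow> slope \<Psi> \<psi> p q \<le> M"
    using slope_bounded by metis
  note bound = path_growth_bound[OF FG M(2)]
  note gm = measurable_path_growth[OF FG]
  have G: "subdf (extend_path G 0)" using FG by (auto simp: ac_path_pairs_def subdf_extend_path)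
  note [measurable] = borel_measurable_curry[OF gm] subdf_measurable[OF G]
  \<comment> \<open>\<open>g\<close> uses extended paths at every real \<open>x\<close>, so it is
    Borel on the line; its agreement with \<open>C_operator\<close> is known for
    \<open>x \<ge> 0\<close>, which suffices under the indicator.\<close>
  define g where "g x = extend_path G 0 (exp (- t) * x) + (LINT u:{0..t}|lborel. path_growth F G u (exp (u - t) * x))" for x
  have gmeas: "g \<in> borel_measurable lborel"
    unfolding g_def set_lebesgue_integral_def by measurable
  have "set_integrable lborel {0..real k} (C_operator \<Psi> F G t)" for k :: nat
  proof -
    have gb: "\<bar>g x\<bar> \<le> 1 + M * real k * t" if x: "x \<in> {0..real k}" for x
    proof -
      have "\<bar>LINT u:{0..t}|lborel. path_growth F G u (exp (u - t) * x)\<bar>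
        \<le> (LINT u:{0..t}|lborel. \<bar>path_growth F G u (exp (u - t) * x)\<bar>)"
        unfolding set_lebesgue_integral_def by (rule order_trans[OF integral_abs_bound]) (simp add: abs_mult)
      also have "\<dots> \<le> (LINT u:{0..t}|lborel. M * real k)"
      proof (rule set_integral_mono)
        show "set_integrable lborel {0..t} (\<lambda>u. \<bar>path_growth F G u (exp (u - t) * x)\<bar>)"
          by (intro set_integrable_abs set_integrable_transport[OF gm bound])
        show "set_integrable lborel {0..t} (\<lambda>u. M * real k)"
          by (simp add: set_integrable_def emeasure_lborel_Icc_eq)
        show "\<bar>path_growth F G u (exp (u - t) * x)\<bar> \<le> M * real k" if u: "u \<in> {0..t}" for u
        proof -
          have "\<bar>exp (u - t) * x\<bar> \<le> 1 * real k"
            using u x unfolding abs_mult by (intro mult_mono) auto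
          then have "M * \<bar>exp (u - t) * x\<bar> \<le> M * real k"
            using M(1) by (intro mult_left_mono) auto
          with bound[of u "exp (u - t) * x"] show ?thesis by linarith
        qed
      qed
      also have "\<dots> = M * real k * t" using t by (simp add: set_integral_const)
      finally show ?thesis
        using subdf_nonneg[OF G, of "exp (- t) * x"] subdf_le_1[OF G, of "exp (- t) * x"]
        unfolding g_def by linarith
    qed
    have "set_integrable lborel {0..real k} g"
      unfolding set_integrable_def
      by (rule integrableI_bounded_set[where A="{0..real k}" and B="1 + M * real k * t"])
        (use gmeas gb in \<open>auto simp: indicator_def emeasure_lborel_Icc_eq\<close>)
    moreover have "indicat_real {0..real k} x *\<^sub>R C_operator \<Psi> F G t x = indicat_real {0..real k} x *\<^sub>R g x" for x
      using C_operator_eq[OF FG t, of x] by (simp add: g_def indicator_def)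
    ultimately show ?thesis unfolding set_integrable_def by presburger
  qed
  then show ?thesis by (simp add: L1_loc_def)
qed

text \<open>At a fixed time, continuity of the slice of \<open>F\<close> passes to that of
  \<open>G\<close> by absolute continuity, and so L1 convergence becomes pointwise for both.
  Uniformity in time is recovered only after integration.\<close>

lemma path_growth_tendsto:
  assumes Fn: "\<And>n. (Fn n, Gn n) \<in> ac_path_pairs" and FG: "(F, G) \<in> ac_path_pairs"
    and F: "converges_locally_uniformly Fn F" and G: "converges_locally_uniformly Gn G"
    and cont: "continuous_on ({0..} \<times> {0..}) (\<lambda>(t, x). F t x)"
    and u: "0 \<le> u"
  shows "(\<lambda>n. path_growth (Fn n) (Gn n) u y) \<longlonglongrightarrow> path_growth F G u y"
proof (cases "0 < y")
  case True
  have sub: "subdf (extend_path F u)" "subdf (extend_path G u)"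
    "\<And>n. subdf (extend_path (Fn n) u)" "\<And>n. subdf (extend_path (Gn n) u)"
    using FG Fn by (auto simp: ac_path_pairs_def subdf_extend_path)
  have "continuous_on UNIV (\<lambda>x. (\<lambda>(t, x). F t x) (u, max 0 x))"
    by (rule continuous_on_compose2[OF cont]) (use u in \<open>auto intro!: continuous_intros\<close>)
  then have contF: "isCont (extend_path F u) x" for x
    using u by (simp add: extend_path_def[abs_def] max_def continuous_on_eq_continuous_at)
  have "absolutely_continuous (interval_measure (extend_path F u)) (interval_measure (extend_path G u))"
    using FG u by (auto simp: ac_path_pairs_def stieltjes_def extend_path_def[abs_def] max_def)
  then have contG: "isCont (extend_path G u) x" for x
    using isCont_absolutely_continuous[OF sub(1,2)] contF by blast
  have "(\<lambda>n. extend_path (Fn n) u x) \<longlonglongrightarrow> extend_path F u x" if "x > 0" for x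
    by (rule subdf_tendsto_of_L1[OF sub(1,3) that contF])
      (simp add: nn_integral_extend_path[OF u] converges_locally_uniformly_at[OF F u])
  moreover have "(\<lambda>n. extend_path (Gn n) u x) \<longlonglongrightarrow> extend_path G u x" if "x > 0" for x
    by (rule subdf_tendsto_of_L1[OF sub(2,4) that contG])
      (simp add: nn_integral_extend_path[OF u] converges_locally_uniformly_at[OF G u])
  ultimately have "(\<lambda>n. inner_integral (extend_path (Fn n) u) (extend_path (Gn n) u) y)
      \<longlonglongrightarrow> inner_integral (extend_path F u) (extend_path G u) y"
    using True contF by (intro inner_integral_tendsto sub) auto
  then show ?thesis using True by (auto simp: growth_def intro: tendsto_mult_left)
qed (simp add: growth_def)

text \<open>The supremum over \<open>s\<close> is dominated by an expression without
  \<open>s\<close>: \<open>A n\<close> is the error of \<open>G\<close> at time 0, transported along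
  \<open>exp (- s) * x\<close>, and \<open>B n\<close> is the space-time error of the growth
  term.\<close>

lemma C_operator_converges:
  assumes Fn: "\<And>n. (Fn n, Gn n) \<in> ac_path_pairs" and FG: "(F, G) \<in> ac_path_pairs"
    and F: "converges_locally_uniformly Fn F" and G: "converges_locally_uniformly Gn G"
    and cont: "continuous_on ({0..} \<times> {0..}) (\<lambda>(t, x). F t x)"
  shows "converges_locally_uniformly (\<lambda>n. C_operator \<Psi> (Fn n) (Gn n)) (C_operator \<Psi> F G)"
  unfolding converges_locally_uniformly_def
proof (intro conjI allI impI)
  show "C_operator \<Psi> (Fn n) (Gn n) s \<in> L1_loc" if "0 \<le> s" for n s
    by (rule C_operator_L1_loc[OF Fn that])
  show "C_operator \<Psi> F G s \<in> L1_loc" if "0 \<le> s" for s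
    by (rule C_operator_L1_loc[OF FG that])
  fix K :: "real set" and t :: real
  assume Kt: "compact K \<and> K \<subseteq> {0..} \<and> 0 < t"
  then obtain k where k: "K \<subseteq> {0..k}"
    using compact_imp_bounded[of K] by (fastforce simp: bounded_real dest: abs_le_D1)
  obtain M where M: "\<And>p q. \<lbrakk>0 \<le> p; p \<le> q; q \<le> 1\<rbrakk> \<Longrightarrow> slope \<Psi> \<psi> p q \<le> M"
    using slope_bounded by metis
  let ?h = "path_growth F G" and ?hn = "\<lambda>n. path_growth (Fn n) (Gn n)"
  note hm = measurable_path_growth[OF FG] and hnm = measurable_path_growth[OF Fn]
  note hb = path_growth_bound[OF FG M] and hnb = path_growth_bound[OF Fn M]
  define A where "A n = (\<integral>\<^sup>+x\<in>{0..k}. ennreal \<bar>Gn n 0 x - G 0 x\<bar> \<partial>lborel)" for n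
  define B where "B n = (\<integral>\<^sup>+u\<in>{0..t}. (\<integral>\<^sup>+y\<in>{0..k}. ennreal \<bar>?hn n u y - ?h u y\<bar> \<partial>lborel) \<partial>lborel)" for n
  have "A \<longlonglongrightarrow> 0" unfolding A_def by (rule converges_locally_uniformly_at[OF G]) simp
  moreover have "B \<longlonglongrightarrow> 0"
    unfolding B_def by (rule nn_integral_diff_tendsto_0[OF hm hnm hnb path_growth_tendsto[OF assms]])
  ultimately have "(\<lambda>n. ennreal (exp t) * (A n + B n)) \<longlonglongrightarrow> ennreal (exp t) * (0 + 0)"
    by (intro ennreal_tendsto_cmult tendsto_add) auto
  then have lim: "(\<lambda>n. ennreal (exp t) * (A n + B n)) \<longlonglongrightarrow> 0" by simp
  have le: "(SUP s\<in>{0..t}. \<integral>\<^sup>+x\<in>K. ennreal \<bar>C_operator \<Psi> (Fn n) (Gn n) s x - C_operator \<Psi> F G s x\<bar> \<partial>lborel)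
      \<le> ennreal (exp t) * (A n + B n)" for n
  proof (rule SUP_least)
    fix s assume s: "s \<in> {0..t}"
    let ?a = "\<lambda>x. \<bar>extend_path (Gn n) 0 x - extend_path G 0 x\<bar>"
    let ?b = "\<lambda>x. \<bar>(LINT u:{0..s}|lborel. ?hn n u (exp (u - s) * x)) - (LINT u:{0..s}|lborel. ?h u (exp (u - s) * x))\<bar>"
    have sub: "subdf (extend_path G 0)" "subdf (extend_path (Gn n) 0)"
      using FG Fn by (auto simp: ac_path_pairs_def subdf_extend_path)
    note [measurable] = borel_measurable_curry[OF hm] borel_measurable_curry[OF hnm]
      subdf_measurable[OF sub(1)] subdf_measurable[OF sub(2)]
    have "(\<integral>\<^sup>+x\<in>K. ennreal \<bar>C_operator \<Psi> (Fn n) (Gn n) s x - C_operator \<Psi> F G s x\<bar> \<partial>lborel)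
      \<le> (\<integral>\<^sup>+x. ennreal (?a (exp (- s) * x)) * indicator {0..k} x + ennreal (?b x) * indicator {0..k} x \<partial>lborel)"
    proof (intro nn_integral_mono)
      fix x
      have "\<bar>C_operator \<Psi> (Fn n) (Gn n) s x - C_operator \<Psi> F G s x\<bar> \<le> ?a (exp (- s) * x) + ?b x" if "0 \<le> x"
        using s that C_operator_eq[OF Fn, of s x n] C_operator_eq[OF FG, of s x] by simp
      then show "ennreal \<bar>C_operator \<Psi> (Fn n) (Gn n) s x - C_operator \<Psi> F G s x\<bar> * indicator K x
        \<le> ennreal (?a (exp (- s) * x)) * indicator {0..k} x + ennreal (?b x) * indicator {0..k} x"
        using k by (auto simp: indicator_def simp flip: ennreal_plus intro!: ennreal_leI)
    qed
    also have "\<dots> = (\<integral>\<^sup>+x\<in>{0..k}. ennreal (?a (exp (- s) * x)) \<partial>lborel) + (\<integral>\<^sup>+x\<in>{0..k}. ennreal (?b x) \<partial>lborel)"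
      unfolding set_lebesgue_integral_def by (rule nn_integral_add) measurable
    also have "\<dots> \<le> ennreal (exp t) * A n + ennreal (exp t) * B n"
    proof (rule add_mono)
      have "(\<integral>\<^sup>+x\<in>{0..k}. ennreal (?a (exp (- s) * x)) \<partial>lborel) \<le> ennreal (exp t) * (\<integral>\<^sup>+x\<in>{0..k}. ennreal (?a x) \<partial>lborel)"
        using s by (intro nn_integral_Icc_scale_le) (auto simp: divide_inverse simp flip: exp_minus)
      then show "(\<integral>\<^sup>+x\<in>{0..k}. ennreal (?a (exp (- s) * x)) \<partial>lborel) \<le> ennreal (exp t) * A n"
        by (simp add: nn_integral_extend_path A_def)
      show "(\<integral>\<^sup>+x\<in>{0..k}. ennreal (?b x) \<partial>lborel) \<le> ennreal (exp t) * B n"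
        unfolding B_def using s by (intro transport_diff_le[OF hnm hm hnb hb]) auto
    qed
    finally show "(\<integral>\<^sup>+x\<in>K. ennreal \<bar>C_operator \<Psi> (Fn n) (Gn n) s x - C_operator \<Psi> F G s x\<bar> \<partial>lborel)
      \<le> ennreal (exp t) * (A n + B n)"
      by (simp add: distrib_left)
  qed
  show "(\<lambda>n. SUP s\<in>{0..t}. \<integral>\<^sup>+x\<in>K. ennreal \<bar>C_operator \<Psi> (Fn n) (Gn n) s x - C_operator \<Psi> F G s x\<bar> \<partial>lborel) \<longlonglongrightarrow> 0"
    by (rule tendsto_sandwich[OF _ _ tendsto_const lim]) (use le in auto)
qed

end

theorem proposition2p5:
  fixes \<Psi> :: "real \<Rightarrow> real"
    and Fn Gn :: "nat \<Rightarrow> real \<Rightarrow> real \<Rightarrow> real"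
    and F G :: "real \<Rightarrow> real \<Rightarrow> real"
  assumes "distribution_function {0..1} {0<..1} \<Psi>"
    and "\<And>n. (Fn n, Gn n) \<in> ac_path_pairs"
    and "(F, G) \<in> ac_path_pairs"
    and "C1_on_unit_interval \<Psi>"
    and "converges_locally_uniformly Fn F"
    and "converges_locally_uniformly Gn G"
    and "continuous_on ({0..} \<times> {0..}) (\<lambda>(t, x). F t x)"
    and "tight_distribution_family F"
  shows "(F, G) \<in> ac_path_pairs \<and>
    converges_locally_uniformly (\<lambda>n. C_operator \<Psi> (Fn n) (Gn n)) (C_operator \<Psi> F G)"
proof -
  obtain \<psi> where \<psi>: "continuous_on {0..1} \<psi>"
    "\<And>u. u \<in> {0..1} \<Longrightarrow> (\<Psi> has_real_derivative \<psi> u) (at u within {0..1})"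
    using assms(4) by (auto simp: C1_on_unit_interval_def)
  obtain \<mu> where \<mu>: "real_distribution \<mu>" and cdf: "\<And>u. u \<in> {0..1} \<Longrightarrow> \<Psi> u = cdf \<mu> u"
    using assms(1) by (auto simp: distribution_function_def)
  interpret real_distribution \<mu> by (rule \<mu>)
  \<comment> \<open>\<open>\<Psi>\<close> agrees with a cdf on [0,1] only, which is exactly where
    the locale looks at it.\<close>
  interpret C1_unit \<Psi> \<psi>
  proof
    show "mono_on {0..1} \<Psi>"
      using cdf by (auto simp: mono_on_def cdf_nondecreasing)
    show "\<Psi> u \<in> {0..1}" if "u \<in> {0..1}" for u
      using cdf[OF that] cdf_nonneg[of u] cdf_bounded_prob[of u] by simp
  qed (use \<psi> in auto)
  show ?thesis
    using C_operator_converges[OF assms(2,3,5,6,7)] assms(3) by blast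
qed

end
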